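(* Let $d\ge 2$, let $N=2^n$, let $s$ be a positive integer, and fix positive integers $p$ and $q$. Let $\mathcal A:\mathbb C^{N^d}\to\mathbb C^{p}$ be a linear operator such that, composed with the orthonormal discrete $d$-dimensional Haar wavelet transform $\mathcal H$, the operator $\mathcal A\mathcal H^{*}:\mathbb C^{N^d}\to\mathbb C^p$ has the restricted isometry property of order $2ds$ and level $\delta<1$. Let $\mathcal B_1,\dots,\mathcal B_d$, with $\mathcal B_\ell:\mathbb C^{N^{\ell-1}\times(N-1)\times N^{d-\ell}}\to\mathbb C^{q}$ linear, be such that the column direct sum $\mathcal B=\mathcal B_1\oplus_c\mathcal B_2\oplus_c\cdots\oplus_c\mathcal B_d$, i.e. $\mathcal B(\boldsymbol w_1,\dots,\boldsymbol w_d)=\sum_{\ell=1}^d\mathcal B_\ell(\boldsymbol w_\ell)$, has the restricted isometry property of order $5ds$ and level $\delta<1/3$ (the levels for $\mathcal A\mathcal H^*$ and for $\mathcal B$ need not be the same number). Set $m=2dq+p$, and let $\mathcal M:\mathbb C^{N^d}\to\mathbb C^m$ be the linear operator obtained by stacking (concatenating the outputs of) $$\mathcal A,\ [\mathcal B_1]^{0_1},\ [\mathcal B_1]_{0_1},\ \dots,\ [\mathcal B_\ell]^{0_\ell},\ [\mathcal B_\ell]_{0_\ell},\ \dots,\ [\mathcal B_d]^{0_d},\ [\mathcal B_d]_{0_d}.$$ The following holds for any $\boldsymbol x\in\mathbb C^{N^d}$. From noisy measurements $\boldsymbol y=\mathcal M(\boldsymbol x)+\boldsymbol\xi$ with noise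 level $\|\boldsymbol\xi\|_2\le\varepsilon$, the solution $$\hat{\boldsymbol x}=\operatorname*{arg\,min}_{\boldsymbol z}\|\boldsymbol z\|_{TV_2}\quad\text{such that}\quad\|\mathcal M(\boldsymbol z)-\boldsymbol y\|_2\le\varepsilon$$ satisfies: (i) $\|\nabla(\boldsymbol x-\hat{\boldsymbol x})\|_2\lesssim\dfrac{\|\nabla\boldsymbol x-(\nabla\boldsymbol x)_S\|_{1,2}}{\sqrt s}+\sqrt d\,\varepsilon$, (ii) $\|\boldsymbol x-\hat{\boldsymbol x}\|_{TV_2}\lesssim\|\nabla\boldsymbol x-(\nabla\boldsymbol x)_S\|_{1,2}+\sqrt{sd}\,\varepsilon$, (iii) $\|\boldsymbol x-\hat{\boldsymbol x}\|_2\lesssim\log(N^d)\Big(\dfrac{\|\nabla\boldsymbol x-(\nabla\boldsymbol x)_S\|_{1,2}}{\sqrt s}+\sqrt d\,\varepsilon\Big)$. Here $(\nabla\boldsymbol x)_S$ is the gradient $\nabla\boldsymbol x$ restricted to $S=\{\alpha_{(1)},\dots,\alpha_{(s)}\}\times\{1,\dots,d\}$ (set to zero off $S$), where $\alpha_{(1)},\dots,\alpha_{(s)}\in\{1,\dots,N\}^d$ are the indices of the $s$ largest block norms $\|(\nabla\boldsymbol x)_\alpha\|_2$; and $u\lesssim v$ means that there is an absolute constant $C>0$ such that $u\le Cv$.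
   Context: **Arrays.** $\mathbb C^{N^d}$ is the space of arrays $\boldsymbol x=(x_\alpha)$, $\alpha\in[N]^d=\{1,\dots,N\}^d$, with inner product $\langle\boldsymbol x,\boldsymbol y\rangle=\sum_\alpha x_\alpha\overline{y_\alpha}$; $\|\cdot\|_2$ is the entrywise $\ell_2$ norm of any array. If the minimizer in an $\arg\min$ is not unique, one solution is chosen (lexicographically). **Gradient and total variation.** For $\ell=1,\dots,d$ the directional derivative $\boldsymbol x_{r_\ell}\in\mathbb C^{N^{\ell-1}\times(N-1)\times N^{d-\ell}}$ is $(\boldsymbol x_{r_\ell})_\alpha=x_{(\alpha_1,\dots,\alpha_\ell+1,\dots,\alpha_d)}-x_\alpha$ (for $1\le\alpha_\ell\le N-1$). The gradient $\nabla\boldsymbol x\in\mathbb C^{N^d\times d}$ is $(\nabla\boldsymbol x)_{\alpha,\ell}=(\boldsymbol x_{r_\ell})_\alpha$ if $\alpha_\ell\le N-1$ and $0$ otherwise. For $\boldsymbol w\in\mathbb C^{N^d\times d}$ write $\boldsymbol w_\alpha=(w_{\alpha,\ell})_{\ell=1}^d\in\mathbb C^d$ and $\|\boldsymbol w\|_{1,2}=\sum_{\alpha\in[N]^d}\big(\sum_{\ell=1}^d|w_{\alpha,\ell}|^2\big)^{1/2}$. The isotropic total variation seminorm is $\|\boldsymbol x\|_{TV_2}=\|\nabla\boldsymbol x\|_{1,2}$. **Restricted isometry property (RIP).** A linear operator $\mathcal L$ from a finite-dimensional space of complex arrays to some $\mathbb C^r$ has the RIP of order $k$ and level $\delta\in(0,1)$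 if $(1-\delta)\|\boldsymbol z\|_2^2\le\|\mathcal L(\boldsymbol z)\|_2^2\le(1+\delta)\|\boldsymbol z\|_2^2$ for every array $\boldsymbol z$ with at most $k$ nonzero entries. **Zero-padded operators.** For $\boldsymbol a\in\mathbb C^{N^{\ell-1}\times(N-1)\times N^{d-\ell}}$ define $\boldsymbol a^{0_\ell},\boldsymbol a_{0_\ell}\in\mathbb C^{N^d}$ by: $(\boldsymbol a^{0_\ell})_\alpha=0$ if $\alpha_\ell=1$ and $=a_{(\alpha_1,\dots,\alpha_\ell-1,\dots,\alpha_d)}$ if $2\le\alpha_\ell\le N$; $(\boldsymbol a_{0_\ell})_\alpha=0$ if $\alpha_\ell=N$ and $=a_\alpha$ if $1\le\alpha_\ell\le N-1$. An operator $\mathcal B_\ell:\mathbb C^{N^{\ell-1}\times(N-1)\times N^{d-\ell}}\to\mathbb C^q$ is identified with a sequence of arrays $(\boldsymbol b_k)_{k=1}^q$, where the $k$-th output is the inner product of the input with $\boldsymbol b_k$. Then $[\mathcal B_\ell]^{0_\ell}$ and $[\mathcal B_\ell]_{0_\ell}$ are the operators $\mathbb C^{N^d}\to\mathbb C^q$ given in the same way by $((\boldsymbol b_k)^{0_\ell})_{k=1}^q$ and $((\boldsymbol b_k)_{0_\ell})_{k=1}^q$. **Discrete Haar transform.** Let $h^0=1_{[0,1)}$ and $h^1=1_{[0,1/2)}-1_{[1/2,1)}$. For $\boldsymbol e\in V=\{0,1\}^d\setminus\{0\}$ let $h^{\boldsymbol e}(u)=\prod_{i=1}^d h^{e_i}(u_i)$,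 and $h^{\boldsymbol e}_{j,k}(u)=2^{jd/2}h^{\boldsymbol e}(2^ju-k)$ for $0\le j\le n-1$, $k\in\{0,\dots,2^j-1\}^d$. Set $\boldsymbol h_0(\alpha)=N^{-d/2}$ and $\boldsymbol h_{j,k,\boldsymbol e}(\alpha)=N^{-d/2}h^{\boldsymbol e}_{j,k}((\alpha-\mathbf 1)/N)$, where $\mathbf 1=(1,\dots,1)$. These $N^d$ arrays form an orthonormal basis of $\mathbb C^{N^d}$, and $\mathcal H(\boldsymbol x)$ is the array of coefficients of $\boldsymbol x$ in this basis; $\mathcal H$ is unitary and $\mathcal H^*=\mathcal H^{-1}$.
   Formalization: The constant in (iii) is allowed to depend on d and on the RIP level of AH* (bounds (i), (ii) keep an absolute constant), and N ≥ 2 (n ≥ 1) is assumed; with a constant absolute in d or in that level, or with N = 1, (iii) is false. *)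

theory Defs
  imports "HOL-Analysis.Analysis"
begin

text \<open>
  The dimension \<open>d\<close>, the side length \<open>N\<close> and the numbers of measurements vary inside the theorem,
  so they cannot be types. An element of \<open>\<complex>\<^sup>I\<close>, for a finite index set \<open>I\<close>, is represented by a total
  function \<open>'i \<Rightarrow> complex\<close>; only its values on \<open>I\<close> are significant. The space \<open>\<complex>\<^sup>r\<close> has index set
  \<open>{..<r}\<close>.
\<close>

definition inner_on :: "'i set \<Rightarrow> ('i \<Rightarrow> complex) \<Rightarrow> ('i \<Rightarrow> complex) \<Rightarrow> complex" where
  "inner_on I x y = (\<Sum>i\<in>I. x i * cnj (y i))"

definition l2norm :: "'i set \<Rightarrow> ('i \<Rightarrow> complex) \<Rightarrow> real" where
  "l2norm I x = sqrt (\<Sum>i\<in>I. (cmod (x i))\<^sup>2)"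

text \<open>Linear operators from \<open>\<complex>\<^sup>I\<close> to \<open>\<complex>\<^sup>r\<close>. The last clause says that values off \<open>I\<close> are ignored.\<close>

definition linear_op ::
    "'i set \<Rightarrow> nat \<Rightarrow> (('i \<Rightarrow> complex) \<Rightarrow> nat \<Rightarrow> complex) \<Rightarrow> bool" where
  "linear_op I r L \<longleftrightarrow>
     (\<forall>x y. \<forall>k<r. L (\<lambda>i. x i + y i) k = L x k + L y k) \<and>
     (\<forall>c x. \<forall>k<r. L (\<lambda>i. c * x i) k = c * L x k) \<and>
     (\<forall>x y. (\<forall>i\<in>I. x i = y i) \<longrightarrow> (\<forall>k<r. L x k = L y k))"

definition RIP ::
    "'i set \<Rightarrow> nat \<Rightarrow> (('i \<Rightarrow> complex) \<Rightarrow> nat \<Rightarrow> complex) \<Rightarrow> nat \<Rightarrow> real \<Rightarrow> bool" where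
  "RIP I r L k \<delta> \<longleftrightarrow> 0 < \<delta> \<and> \<delta> < 1 \<and>
     (\<forall>z. card {i\<in>I. z i \<noteq> 0} \<le> k \<longrightarrow>
        (1 - \<delta>) * (l2norm I z)\<^sup>2 \<le> (l2norm {..<r} (L z))\<^sup>2 \<and>
        (l2norm {..<r} (L z))\<^sup>2 \<le> (1 + \<delta>) * (l2norm I z)\<^sup>2)"

text \<open>The sequence of arrays with which a linear operator is identified, and conversely.\<close>

definition arrays_of_op ::
    "(('i \<Rightarrow> complex) \<Rightarrow> nat \<Rightarrow> complex) \<Rightarrow> nat \<Rightarrow> 'i \<Rightarrow> complex" where
  "arrays_of_op L k i = cnj (L (\<lambda>j. if j = i then 1 else 0) k)"

definition op_of_arrays ::
    "'i set \<Rightarrow> (nat \<Rightarrow> 'i \<Rightarrow> complex) \<Rightarrow> ('i \<Rightarrow> complex) \<Rightarrow> nat \<Rightarrow> complex" where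
  "op_of_arrays I b x k = inner_on I x (b k)"

lemma op_of_arrays_of_op:
  assumes fin: "finite I" and lin: "linear_op I r L" and k: "k < r"
  shows "op_of_arrays I (arrays_of_op L) x k = L x k"
proof -
  have add: "L (\<lambda>i. x i + y i) k = L x k + L y k" for x y
    using lin k by (simp add: linear_op_def)
  have scale: "L (\<lambda>i. c * x i) k = c * L x k" for c x
    using lin k by (simp add: linear_op_def)
  have zero: "L (\<lambda>i. 0) k = 0"
    using scale[of 0 "\<lambda>_. 0"] by simp
  have "finite J \<Longrightarrow> L (\<lambda>i. if i \<in> J then x i else 0) k =
      (\<Sum>i\<in>J. x i * L (\<lambda>j. if j = i then 1 else 0) k)" for J
  proof (induction J rule: finite_induct)
    case empty
    then show ?case using zero by simp
  next
    case (insert a J)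
    have "(\<lambda>i. if i \<in> insert a J then x i else 0) =
        (\<lambda>i. x a * (if i = a then 1 else 0) + (if i \<in> J then x i else 0))"
      using insert.hyps by auto
    then have "L (\<lambda>i. if i \<in> insert a J then x i else 0) k =
        x a * L (\<lambda>i. if i = a then 1 else 0) k + L (\<lambda>i. if i \<in> J then x i else 0) k"
      by (simp only: add scale)
    then show ?case
      by (simp only: insert.IH sum.insert[OF insert.hyps])
  qed
  from this[OF fin] have "(\<Sum>i\<in>I. x i * L (\<lambda>j. if j = i then 1 else 0) k) =
      L (\<lambda>i. if i \<in> I then x i else 0) k" by simp
  also have "\<dots> = L x k"
    using lin k by (simp add: linear_op_def)
  finally show ?thesis
    by (simp add: op_of_arrays_def inner_on_def arrays_of_op_def)
qed


subsection \<open>Gradient and total variation\<close>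

type_synonym mindex = "nat \<Rightarrow> nat"

definition grid :: "nat \<Rightarrow> nat \<Rightarrow> mindex set" where
  "grid d N = {1..d} \<rightarrow>\<^sub>E {1..N}"

text \<open>The index set of arrays of format \<open>N\<^bsup>l-1\<^esup> \<times> (N-1) \<times> N\<^bsup>d-l\<^esup>\<close>.\<close>

definition edge_grid :: "nat \<Rightarrow> nat \<Rightarrow> nat \<Rightarrow> mindex set" where
  "edge_grid d N l = {\<alpha> \<in> grid d N. \<alpha> l \<le> N - 1}"

definition dir_deriv :: "nat \<Rightarrow> (mindex \<Rightarrow> complex) \<Rightarrow> mindex \<Rightarrow> complex" where
  "dir_deriv l x \<alpha> = x (\<alpha>(l := \<alpha> l + 1)) - x \<alpha>"

definition grad :: "nat \<Rightarrow> (mindex \<Rightarrow> complex) \<Rightarrow> mindex \<times> nat \<Rightarrow> complex" where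
  "grad N x = (\<lambda>(\<alpha>, l). if \<alpha> l \<le> N - 1 then dir_deriv l x \<alpha> else 0)"

definition block_norm :: "nat \<Rightarrow> (mindex \<times> nat \<Rightarrow> complex) \<Rightarrow> mindex \<Rightarrow> real" where
  "block_norm d w \<alpha> = l2norm {1..d} (\<lambda>l. w (\<alpha>, l))"

definition norm12 :: "nat \<Rightarrow> nat \<Rightarrow> (mindex \<times> nat \<Rightarrow> complex) \<Rightarrow> real" where
  "norm12 d N w = (\<Sum>\<alpha>\<in>grid d N. block_norm d w \<alpha>)"

definition TV2 :: "nat \<Rightarrow> nat \<Rightarrow> (mindex \<Rightarrow> complex) \<Rightarrow> real" where
  "TV2 d N x = norm12 d N (grad N x)"

definition restrict_arr :: "'i set \<Rightarrow> ('i \<Rightarrow> complex) \<Rightarrow> 'i \<Rightarrow> complex" where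
  "restrict_arr S w i = (if i \<in> S then w i else 0)"

text \<open>
  \<open>T\<close> consists of the indices of \<open>s\<close> largest blocks of \<open>w\<close>, ties being broken in any way; if there are
  fewer than \<open>s\<close> blocks, \<open>T\<close> consists of all indices.
\<close>

definition largest_blocks ::
    "nat \<Rightarrow> nat \<Rightarrow> nat \<Rightarrow> (mindex \<times> nat \<Rightarrow> complex) \<Rightarrow> mindex set \<Rightarrow> bool" where
  "largest_blocks d N s w T \<longleftrightarrow>
     T \<subseteq> grid d N \<and> card T = min s (N ^ d) \<and>
     (\<forall>\<alpha>\<in>T. \<forall>\<beta>\<in>grid d N - T. block_norm d w \<beta> \<le> block_norm d w \<alpha>)"


subsection \<open>Zero-padded operators, direct sum and stacking\<close>

text \<open>\<open>pad_first l a\<close> is \<open>a\<^bsup>0\<^sub>l\<^esup>\<close> and \<open>pad_last N l a\<close> is \<open>a\<close> with subscript \<open>0\<^sub>l\<close>.\<close>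

definition pad_first :: "nat \<Rightarrow> (mindex \<Rightarrow> complex) \<Rightarrow> mindex \<Rightarrow> complex" where
  "pad_first l a \<alpha> = (if \<alpha> l = 1 then 0 else a (\<alpha>(l := \<alpha> l - 1)))"

definition pad_last :: "nat \<Rightarrow> nat \<Rightarrow> (mindex \<Rightarrow> complex) \<Rightarrow> mindex \<Rightarrow> complex" where
  "pad_last N l a \<alpha> = (if \<alpha> l = N then 0 else a \<alpha>)"

definition op_pad_first ::
    "nat \<Rightarrow> nat \<Rightarrow> nat \<Rightarrow> ((mindex \<Rightarrow> complex) \<Rightarrow> nat \<Rightarrow> complex) \<Rightarrow>
     (mindex \<Rightarrow> complex) \<Rightarrow> nat \<Rightarrow> complex" where
  "op_pad_first d N l L = op_of_arrays (grid d N) (\<lambda>k. pad_first l (arrays_of_op L k))"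

definition op_pad_last ::
    "nat \<Rightarrow> nat \<Rightarrow> nat \<Rightarrow> ((mindex \<Rightarrow> complex) \<Rightarrow> nat \<Rightarrow> complex) \<Rightarrow>
     (mindex \<Rightarrow> complex) \<Rightarrow> nat \<Rightarrow> complex" where
  "op_pad_last d N l L = op_of_arrays (grid d N) (\<lambda>k. pad_last N l (arrays_of_op L k))"

text \<open>The domain of the column direct sum: tuples \<open>(w\<^sub>1, \<dots>, w\<^sub>d)\<close> as arrays indexed by pairs \<open>(l, \<alpha>)\<close>.\<close>

definition dsum_index :: "nat \<Rightarrow> nat \<Rightarrow> (nat \<times> mindex) set" where
  "dsum_index d N = Sigma {1..d} (edge_grid d N)"

definition col_dsum ::
    "nat \<Rightarrow> (nat \<Rightarrow> (mindex \<Rightarrow> complex) \<Rightarrow> nat \<Rightarrow> complex) \<Rightarrow>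
     (nat \<times> mindex \<Rightarrow> complex) \<Rightarrow> nat \<Rightarrow> complex" where
  "col_dsum d B w k = (\<Sum>l=1..d. B l (\<lambda>\<alpha>. w (l, \<alpha>)) k)"

text \<open>
  The outputs \<open>0, \<dots>, p - 1\<close> are those of \<open>A\<close>; then, for \<open>l = 1, \<dots>, d\<close>, there follow the \<open>q\<close> outputs of
  the first and the \<open>q\<close> outputs of the second zero-padding of \<open>B l\<close>.
\<close>

definition stacked_op ::
    "nat \<Rightarrow> nat \<Rightarrow> nat \<Rightarrow> nat \<Rightarrow> ((mindex \<Rightarrow> complex) \<Rightarrow> nat \<Rightarrow> complex) \<Rightarrow>
     (nat \<Rightarrow> (mindex \<Rightarrow> complex) \<Rightarrow> nat \<Rightarrow> complex) \<Rightarrow>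
     (mindex \<Rightarrow> complex) \<Rightarrow> nat \<Rightarrow> complex" where
  "stacked_op d N p q A B x k =
     (if k < p then A x k
      else let l = (k - p) div (2 * q) + 1; r = (k - p) mod (2 * q)
           in if r < q then op_pad_first d N l (B l) x r
              else op_pad_last d N l (B l) x (r - q))"


subsection \<open>Discrete Haar transform\<close>

definition haar1 :: "nat \<Rightarrow> real \<Rightarrow> real" where
  "haar1 e t = (if e = 0 then indicator {0..<1} t
                else indicator {0..<1/2} t - indicator {1/2..<1} t)"

definition haar_fun :: "nat \<Rightarrow> mindex \<Rightarrow> (nat \<Rightarrow> real) \<Rightarrow> real" where
  "haar_fun d e u = (\<Prod>i=1..d. haar1 (e i) (u i))"

definition haar_wavelet ::
    "nat \<Rightarrow> nat \<Rightarrow> mindex \<Rightarrow> mindex \<Rightarrow> (nat \<Rightarrow> real) \<Rightarrow> real" where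
  "haar_wavelet d j k e u =
     2 powr (real (j * d) / 2) * haar_fun d e (\<lambda>i. 2 ^ j * u i - real (k i))"

text \<open>\<open>None\<close> labels the constant basis array, \<open>Some (j, k, e)\<close> the wavelet of scale \<open>j\<close>, shift \<open>k\<close>, type \<open>e\<close>.\<close>

type_synonym haar_label = "(nat \<times> mindex \<times> mindex) option"

definition haar_index :: "nat \<Rightarrow> nat \<Rightarrow> haar_label set" where
  "haar_index d n = insert None
     (Some ` {(j, k, e). j < n \<and> k \<in> {1..d} \<rightarrow>\<^sub>E {0..<2 ^ j} \<and>
                         e \<in> {1..d} \<rightarrow>\<^sub>E {0, 1} \<and> (\<exists>i\<in>{1..d}. e i \<noteq> 0)})"

definition haar_array :: "nat \<Rightarrow> nat \<Rightarrow> haar_label \<Rightarrow> mindex \<Rightarrow> complex" where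
  "haar_array d N a \<alpha> = complex_of_real
     (case a of
        None \<Rightarrow> real N powr (- real d / 2)
      | Some (j, k, e) \<Rightarrow> real N powr (- real d / 2) *
          haar_wavelet d j k e (\<lambda>i. (real (\<alpha> i) - 1) / real N))"

definition haar_transform ::
    "nat \<Rightarrow> nat \<Rightarrow> (mindex \<Rightarrow> complex) \<Rightarrow> haar_label \<Rightarrow> complex" where
  "haar_transform d n x a = inner_on (grid d (2 ^ n)) x (haar_array d (2 ^ n) a)"

text \<open>The adjoint of the Haar transform: synthesis from coefficients.\<close>

definition haar_adjoint ::
    "nat \<Rightarrow> nat \<Rightarrow> (haar_label \<Rightarrow> complex) \<Rightarrow> mindex \<Rightarrow> complex" where
  "haar_adjoint d n c \<alpha> = (\<Sum>a\<in>haar_index d n. c a * haar_array d (2 ^ n) a \<alpha>)"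

lemma inner_haar_transform:
  "inner_on (haar_index d n) (haar_transform d n x) c =
   inner_on (grid d (2 ^ n)) x (haar_adjoint d n c)"
proof -
  have "inner_on (grid d (2 ^ n)) x (haar_adjoint d n c) =
      (\<Sum>\<alpha>\<in>grid d (2 ^ n). \<Sum>a\<in>haar_index d n.
         x \<alpha> * cnj (haar_array d (2 ^ n) a \<alpha>) * cnj (c a))"
    by (simp add: inner_on_def haar_adjoint_def sum_distrib_left mult_ac)
  also have "\<dots> = inner_on (haar_index d n) (haar_transform d n x) c"
    by (subst sum.swap) (simp add: inner_on_def haar_transform_def sum_distrib_right)
  finally show ?thesis ..
qed

end

theory Submission
  imports Defs
begin

text \<open>
  The zero-paddings satisfy \<open>[B\<^sub>l]\<^bsup>0\<^esup> x - [B\<^sub>l]\<^bsub>0\<^esub> x = B\<^sub>l x\<^bsub>r_l\<^esub>\<close>, so the measurements control \<open>B\<close> applied to the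
  gradient of the error, while minimality of the total variation gives a cone constraint on its blocks.
  Sorting the blocks and using the RIP of \<open>B\<close> yields (i) and (ii).

  For (iii), a Haar coefficient of scale \<open>j\<close> is a sum of differences of the error over half the support of
  the wavelet, in a direction in which the wavelet is antisymmetric. As \<open>d \<ge> 2\<close>, the \<open>\<ell>\<^sub>1\<close> norm of the
  coefficients of each scale and type is at most the total variation, and summing over the \<open>n\<close> scales
  produces the logarithm. No weak-\<open>\<ell>\<^sub>1\<close> estimate for the coefficients is needed: the \<open>\<ell>\<^sub>1\<close> bound is fed into
  the same sorting argument, now with the RIP of \<open>A H\<^sup>*\<close>.
\<close>


subsection \<open>Sorting arguments and the restricted isometry property\<close>

text \<open>The gradient does not see the mean of the error, so no total variation bound exists for
  the constant Haar coefficient. It is therefore kept in the head of the sorting argument and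
  recovered from the RIP of \<open>A H*\<close>. The scales balance for this reason: a wavelet of
  scale j has modulus 2^(-(n-j)d/2) on its support, and for d >= 2 this is at most 1/(2H), where H =
  2^(n-j-1) is the number of steps that get telescoped. Each scale and type then costs at most one
  total variation, whatever j is. The RIP orders are head plus one group: s blocks and 4s further
  blocks of d entries give 5ds, while one constant coefficient and ds others stay below 2ds. The
  factor 4 puts 1/2 in front of the tail, and with \<open>\<delta>\<^sub>B < 1/3\<close> the tail
  can be absorbed with a fixed margin; this makes the constant in (i) and (ii) absolute. In (iii)
  nothing keeps \<open>\<delta>\<^sub>A\<close> away from 1, so 1/sqrt(1 -
  \<open>\<delta>\<^sub>A\<close>) remains, and the wavelet types are counted by 2^d. Hence
  \<open>K\<close> is chosen after d and \<open>\<delta>\<^sub>A\<close>.\<close>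

lemma l2norm_eq_L2_set: "l2norm I x = L2_set (\<lambda>i. cmod (x i)) I"
  by (simp add: l2norm_def L2_set_def)

lemma l2norm_nonneg: "0 \<le> l2norm I x"
  by (simp add: l2norm_eq_L2_set)

lemma l2norm_cong: "(\<And>i. i \<in> I \<Longrightarrow> x i = y i) \<Longrightarrow> l2norm I x = l2norm I y"
  by (simp add: l2norm_def)

lemma l2norm_triangle: "l2norm I (\<lambda>i. x i + y i) \<le> l2norm I x + l2norm I y"
proof -
  have "L2_set (\<lambda>i. cmod (x i + y i)) I \<le> L2_set (\<lambda>i. cmod (x i) + cmod (y i)) I"
    by (intro L2_set_mono norm_triangle_ineq) auto
  also have "\<dots> \<le> L2_set (\<lambda>i. cmod (x i)) I + L2_set (\<lambda>i. cmod (y i)) I"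
    by (rule L2_set_triangle_ineq)
  finally show ?thesis by (simp add: l2norm_eq_L2_set)
qed

lemma l2norm_triangle_diff: "l2norm I (\<lambda>i. x i - y i) \<le> l2norm I x + l2norm I y"
  using l2norm_triangle[of I x "\<lambda>i. - y i"] by (simp add: l2norm_def)

lemma l2norm_power2: "(l2norm I x)\<^sup>2 = (\<Sum>i\<in>I. (cmod (x i))\<^sup>2)"
  by (simp add: l2norm_def sum_nonneg)

lemma norm_le_l2norm: "finite I \<Longrightarrow> i \<in> I \<Longrightarrow> cmod (x i) \<le> l2norm I x"
  unfolding l2norm_eq_L2_set by (rule member_le_L2_set)

lemma exists_largest_subset:
  fixes b :: "'a \<Rightarrow> real"
  assumes "finite G" "m \<le> card G"
  shows "\<exists>R\<subseteq>G. card R = m \<and> (\<forall>g\<in>R. \<forall>h\<in>G - R. b h \<le> b g)"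
  using assms(2)
proof (induction m)
  case 0
  then show ?case by (intro exI[of _ "{}"]) auto
next
  case (Suc m)
  then obtain R where R: "R \<subseteq> G" "card R = m" "\<forall>g\<in>R. \<forall>h\<in>G - R. b h \<le> b g"
    by auto
  have finR: "finite R" using R(1) assms(1) finite_subset by blast
  have "G - R \<noteq> {}" using R Suc.prems by auto
  then have "Max (b ` (G - R)) \<in> b ` (G - R)"
    using assms(1) by (intro Max_in) auto
  then obtain g where g: "g \<in> G - R" "b g = Max (b ` (G - R))" by auto
  have "b h \<le> b g" if "h \<in> G - R" for h
    unfolding g(2) using that assms(1) by (intro Max_ge) auto
  then show ?case
    using R g(1) finR by (intro exI[of _ "insert g R"]) auto
qed

text \<open>
  Sorting the elements by decreasing weight and cutting into groups of size \<open>m\<close>, the \<open>\<ell>\<^sub>2\<close> norm of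
  a group is at most \<open>1/\<surd>m\<close> times the \<open>\<ell>\<^sub>1\<close> norm of its predecessor. The quantified \<open>\<Phi>\<close> replaces the
  sum over all groups but the first.
\<close>

lemma shelling:
  fixes b :: "'a \<Rightarrow> real"
  assumes "finite G" and "\<And>g. g \<in> G \<Longrightarrow> 0 \<le> b g" and m: "m \<ge> 1"
  shows "\<exists>R\<subseteq>G. card R \<le> m \<and>
    (\<forall>\<Phi> c. 0 \<le> c \<longrightarrow> (\<forall>P Q. P \<inter> Q = {} \<longrightarrow> \<Phi> (P \<union> Q) \<le> \<Phi> P + \<Phi> Q) \<longrightarrow>
      (\<forall>Q\<subseteq>G. card Q \<le> m \<longrightarrow> \<Phi> Q \<le> c * L2_set b Q) \<longrightarrow>
      \<Phi> (G - R) \<le> c * (sum b G / sqrt (real m)))"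
  using assms(1,2)
proof (induction G rule: finite_psubset_induct)
  case (psubset G)
  show ?case
  proof (cases "card G \<le> m")
    case True
    \<comment> \<open>Here \<open>R\<close> is all of \<open>G\<close>, so only the empty set is
      left; the third hypothesis at \<open>Q = {}\<close> gives
      \<open>\<Phi> {} \<le> 0\<close>.\<close>
    have "\<Phi> {} \<le> c * (sum b G / sqrt (real m))"
      if "0 \<le> c" "\<forall>Q\<subseteq>G. card Q \<le> m \<longrightarrow> \<Phi> Q \<le> c * L2_set b Q" for \<Phi> :: "'a set \<Rightarrow> real" and c
    proof -
      have "\<Phi> {} \<le> c * L2_set b {}" using that(2) by (metis card.empty empty_subsetI le0)
      also have "\<dots> \<le> c * (sum b G / sqrt (real m))"
        using that(1) psubset.prems by (simp add: sum_nonneg)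
      finally show ?thesis .
    qed
    then show ?thesis using True by (intro exI[of _ G]) simp
  next
    case False
    obtain R where R: "R \<subseteq> G" "card R = m" "\<forall>g\<in>R. \<forall>h\<in>G - R. b h \<le> b g"
      using exists_largest_subset[OF psubset.hyps, of m b] False by auto
    have finR: "finite R" using R(1) psubset.hyps finite_subset by blast
    have Rne: "R \<noteq> {}" using R(2) m by auto
    have "G - R \<subset> G" using R(1) Rne by auto
    from psubset.IH[OF this] psubset.prems obtain R' where R': "R' \<subseteq> G - R" "card R' \<le> m"
      and IH: "\<And>\<Phi> c. 0 \<le> c \<Longrightarrow> (\<forall>P Q. P \<inter> Q = {} \<longrightarrow> \<Phi> (P \<union> Q) \<le> \<Phi> P + \<Phi> Q) \<Longrightarrow>
        (\<forall>Q\<subseteq>G - R. card Q \<le> m \<longrightarrow> \<Phi> Q \<le> c * L2_set b Q) \<Longrightarrow>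
        \<Phi> (G - R - R') \<le> c * (sum b (G - R) / sqrt (real m))"
      by auto
    \<comment> \<open>\<open>\<mu>\<close> separates two consecutive groups: weights in
      \<open>R'\<close> are at most \<open>\<mu>\<close>, weights in \<open>R\<close> at least
      \<open>\<mu>\<close>. So the l2 norm over \<open>R'\<close> is at most sqrt(m)
      \<open>\<mu>\<close>, which is at most the sum over \<open>R\<close> divided by
      sqrt(m).\<close>
    define \<mu> where "\<mu> = Min (b ` R)"
    have \<mu>in: "\<mu> \<in> b ` R" unfolding \<mu>_def using finR Rne by (intro Min_in) auto
    have \<mu>0: "0 \<le> \<mu>" using \<mu>in R(1) psubset.prems by auto
    have "(\<Sum>g\<in>R'. (b g)\<^sup>2) \<le> real (card R') * \<mu>\<^sup>2"
      using R' R(1,3) \<mu>in psubset.prems by (intro sum_bounded_above power_mono) auto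
    also have "\<dots> \<le> real m * \<mu>\<^sup>2"
      using R'(2) by (intro mult_right_mono) auto
    finally have "L2_set b R' \<le> sqrt (real m * \<mu>\<^sup>2)"
      unfolding L2_set_def by (rule real_sqrt_le_mono)
    also have "\<dots> = real m * \<mu> / sqrt (real m)"
      using \<mu>0 m by (simp add: real_sqrt_mult real_div_sqrt field_simps)
    also have "\<dots> \<le> sum b R / sqrt (real m)"
    proof (rule divide_right_mono)
      have "real (card R) * \<mu> \<le> sum b R"
        unfolding \<mu>_def using finR by (intro sum_bounded_below) auto
      then show "real m * \<mu> \<le> sum b R" using R(2) by simp
    qed simp
    finally have L2R': "L2_set b R' \<le> sum b R / sqrt (real m)" .
    have "\<Phi> (G - R) \<le> c * (sum b G / sqrt (real m))"
      if c: "0 \<le> c" and sub: "\<forall>P Q. P \<inter> Q = {} \<longrightarrow> \<Phi> (P \<union> Q) \<le> \<Phi> P + \<Phi> Q"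
        and bd: "\<forall>Q\<subseteq>G. card Q \<le> m \<longrightarrow> \<Phi> Q \<le> c * L2_set b Q"
      for \<Phi> :: "'a set \<Rightarrow> real" and c
    proof -
      have "R' \<union> (G - R - R') = G - R" using R'(1) by auto
      then have "\<Phi> (G - R) \<le> \<Phi> R' + \<Phi> (G - R - R')"
        using sub[rule_format, of R' "G - R - R'"] by auto
      also have "\<Phi> R' \<le> c * (sum b R / sqrt (real m))"
      proof -
        have "\<Phi> R' \<le> c * L2_set b R'" using bd R' by blast
        also have "\<dots> \<le> c * (sum b R / sqrt (real m))"
          using c L2R' by (rule mult_left_mono[rotated])
        finally show ?thesis .
      qed
      also have "\<Phi> (G - R - R') \<le> c * (sum b (G - R) / sqrt (real m))"
        using bd by (intro IH[OF c sub]) auto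
      also have "c * (sum b R / sqrt (real m)) + c * (sum b (G - R) / sqrt (real m))
          = c * (sum b G / sqrt (real m))"
        unfolding sum.subset_diff[OF R(1) psubset.hyps, of b]
        unfolding distrib_left[symmetric] add_divide_distrib[symmetric] by (simp add: add.commute)
      finally show ?thesis by simp
    qed
    then show ?thesis using R by (intro exI[of _ R]) auto
  qed
qed

lemma linear_op_add: "linear_op I r L \<Longrightarrow> k < r \<Longrightarrow> L (\<lambda>i. x i + y i) k = L x k + L y k"
  by (simp add: linear_op_def)

lemma linear_op_cong:
  "linear_op I r L \<Longrightarrow> k < r \<Longrightarrow> (\<And>i. i \<in> I \<Longrightarrow> x i = y i) \<Longrightarrow> L x k = L y k"
  by (simp add: linear_op_def)

lemma linear_op_diff:
  assumes "linear_op I r L" "k < r"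
  shows "L (\<lambda>i. x i - y i) k = L x k - L y k"
  using linear_op_add[OF assms, of "\<lambda>i. x i - y i" y] by simp

lemma L2_set_blocks:
  assumes "finite I" "finite Q"
  shows "L2_set (\<lambda>g. l2norm {i\<in>I. f i = g} w) Q = l2norm {i\<in>I. f i \<in> Q} w"
proof -
  have "(\<Sum>g\<in>Q. \<Sum>i\<in>{i\<in>I. f i = g}. (cmod (w i))\<^sup>2) = (\<Sum>i\<in>{i\<in>I. f i \<in> Q}. (cmod (w i))\<^sup>2)"
  proof -
    have "{i \<in> I. f i = g} = {i \<in> {i\<in>I. f i \<in> Q}. f i = g}" if "g \<in> Q" for g
      using that by auto
    then show ?thesis
      using sum.group[of "{i\<in>I. f i \<in> Q}" Q f "\<lambda>i. (cmod (w i))\<^sup>2"] assms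
      by (auto intro!: sum.cong simp: image_subset_iff)
  qed
  then show ?thesis
    by (simp add: L2_set_def l2norm_power2) (simp add: l2norm_def)
qed

text \<open>The blocks are the fibres of \<open>f\<close>. A first group \<open>R\<close> of at most
  \<open>m\<close> blocks is split off outside \<open>T\<close>, and \<open>u\<close> is the norm of
  \<open>w\<close> on \<open>T\<close> and \<open>R\<close>: the lower RIP bound applies there, the
  upper one to each later group, and shelling adds the later groups up to \<open>\<tau>\<close>.
  Nothing is assumed about \<open>w\<close>; the tail \<open>\<tau>\<close> is controlled
  separately, by the cone constraint for gradients and by the l1 estimate for Haar
  coefficients.\<close>

lemma RIP_block_bound:
  fixes w :: "'i \<Rightarrow> complex" and f :: "'i \<Rightarrow> 'g"
  assumes I: "finite I" and G: "finite G" and f: "\<And>i. i \<in> I \<Longrightarrow> f i \<in> G"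
    and lin: "linear_op I r L" and rip: "RIP I r L k \<delta>"
    and D: "\<And>g. g \<in> G \<Longrightarrow> card {i\<in>I. f i = g} \<le> D"
    and T: "T \<subseteq> G" and m: "1 \<le> m" and k: "D * (card T + m) \<le> k"
  defines "\<tau> \<equiv> (\<Sum>g\<in>G - T. l2norm {i\<in>I. f i = g} w) / sqrt (real m)"
  obtains u where "l2norm {i\<in>I. f i \<in> T} w \<le> u"
    and "sqrt (1 - \<delta>) * u \<le> l2norm {..<r} (L w) + sqrt (1 + \<delta>) * \<tau>"
    and "l2norm I w \<le> u + \<tau>"
proof -
  define b where "b g = l2norm {i\<in>I. f i = g} w" for g
  define part where "part Q = restrict_arr {i. f i \<in> Q} w" for Q
  have \<delta>: "0 < \<delta>" "\<delta> < 1" using rip by (auto simp: RIP_def)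
  have cardle: "card {i\<in>I. part Q i \<noteq> 0} \<le> D * card Q" if "Q \<subseteq> G" for Q
  proof -
    have finQ: "finite Q" using that G finite_subset by blast
    have "card {i\<in>I. part Q i \<noteq> 0} \<le> card (\<Union>g\<in>Q. {i\<in>I. f i = g})"
      using I finQ by (intro card_mono) (auto simp: part_def restrict_arr_def split: if_splits)
    also have "\<dots> \<le> (\<Sum>g\<in>Q. card {i\<in>I. f i = g})"
      using finQ by (rule card_UN_le)
    also have "\<dots> \<le> card Q * D"
      using that D by (intro sum_bounded_above[where K = D, simplified]) auto
    finally show ?thesis by (simp add: mult.commute)
  qed
  have l2part: "l2norm I (part Q) = l2norm {i\<in>I. f i \<in> Q} w" for Q
  proof -
    have "(\<Sum>i\<in>I. (cmod (part Q i))\<^sup>2) = (\<Sum>i\<in>I. if f i \<in> Q then (cmod (w i))\<^sup>2 else 0)"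
      by (intro sum.cong) (auto simp: part_def restrict_arr_def)
    then show ?thesis
      using I by (simp add: l2norm_def sum.inter_filter)
  qed
  have l2L2: "l2norm I (part Q) = L2_set b Q" if "Q \<subseteq> G" for Q
    unfolding l2part b_def using L2_set_blocks[OF I, of Q f w] that G finite_subset by metis
  have add: "part (P \<union> Q) = (\<lambda>i. part P i + part Q i)" if "P \<inter> Q = {}" for P Q
    using that by (auto simp: part_def restrict_arr_def fun_eq_iff)
  have upper: "l2norm {..<r} (L (part Q)) \<le> sqrt (1 + \<delta>) * l2norm I (part Q)"
    and lower: "sqrt (1 - \<delta>) * l2norm I (part Q) \<le> l2norm {..<r} (L (part Q))"
    if "Q \<subseteq> G" "card Q \<le> card T + m" for Q
  proof -
    have "D * card Q \<le> k" using mult_le_mono2[OF that(2), of D] k by linarith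
    with cardle[OF that(1)] have "card {i\<in>I. part Q i \<noteq> 0} \<le> k" by linarith
    then have *: "(1 - \<delta>) * (l2norm I (part Q))\<^sup>2 \<le> (l2norm {..<r} (L (part Q)))\<^sup>2"
      "(l2norm {..<r} (L (part Q)))\<^sup>2 \<le> (1 + \<delta>) * (l2norm I (part Q))\<^sup>2"
      using rip by (auto simp: RIP_def)
    show "l2norm {..<r} (L (part Q)) \<le> sqrt (1 + \<delta>) * l2norm I (part Q)"
      using real_le_rsqrt[OF *(2)] by (simp add: real_sqrt_mult l2norm_nonneg)
    show "sqrt (1 - \<delta>) * l2norm I (part Q) \<le> l2norm {..<r} (L (part Q))"
      using real_le_lsqrt[OF l2norm_nonneg *(1)] by (simp add: real_sqrt_mult l2norm_nonneg)
  qed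
  \<comment> \<open>One \<open>R\<close> has to serve two functionals at once, the norm of a part
    and the norm of its image under \<open>L\<close>; this is why \<open>\<Phi>\<close> is
    quantified after \<open>R\<close>.\<close>
  have "\<exists>R\<subseteq>G - T. card R \<le> m \<and>
    (\<forall>\<Phi> c. 0 \<le> c \<longrightarrow> (\<forall>P Q. P \<inter> Q = {} \<longrightarrow> \<Phi> (P \<union> Q) \<le> \<Phi> P + \<Phi> Q) \<longrightarrow>
      (\<forall>Q\<subseteq>G - T. card Q \<le> m \<longrightarrow> \<Phi> Q \<le> c * L2_set b Q) \<longrightarrow>
      \<Phi> (G - T - R) \<le> c * (sum b (G - T) / sqrt (real m)))"
    using G m by (intro shelling) (auto simp: b_def l2norm_nonneg)
  then obtain R where R: "R \<subseteq> G - T" "card R \<le> m"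
    and sh: "\<And>\<Phi> c. 0 \<le> c \<Longrightarrow> (\<And>P Q. P \<inter> Q = {} \<Longrightarrow> \<Phi> (P \<union> Q) \<le> \<Phi> P + \<Phi> Q) \<Longrightarrow>
      (\<And>Q. Q \<subseteq> G - T \<Longrightarrow> card Q \<le> m \<Longrightarrow> \<Phi> Q \<le> c * L2_set b Q) \<Longrightarrow>
      \<Phi> (G - T - R) \<le> c * \<tau>"
    unfolding \<tau>_def b_def[symmetric] by metis
  define u where "u = l2norm I (part (T \<union> R))"
  have tail: "l2norm I (part (G - T - R)) \<le> 1 * \<tau>"
  proof (rule sh)
    fix Q assume "Q \<subseteq> G - T"
    then have "Q \<subseteq> G" by blast
    then show "l2norm I (part Q) \<le> 1 * L2_set b Q" by (simp add: l2L2)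
  qed (simp_all add: add l2norm_triangle)
  have Ltail: "l2norm {..<r} (L (part (G - T - R))) \<le> sqrt (1 + \<delta>) * \<tau>"
  proof (rule sh)
    show "0 \<le> sqrt (1 + \<delta>)" using \<delta> by simp
    fix P Q :: "'g set" assume "P \<inter> Q = {}"
    then have "l2norm {..<r} (L (part (P \<union> Q)))
        = l2norm {..<r} (\<lambda>k. L (part P) k + L (part Q) k)"
      by (intro l2norm_cong) (simp add: add linear_op_add[OF lin])
    then show "l2norm {..<r} (L (part (P \<union> Q)))
        \<le> l2norm {..<r} (L (part P)) + l2norm {..<r} (L (part Q))"
      by (simp add: l2norm_triangle)
  next
    fix Q assume "Q \<subseteq> G - T" "card Q \<le> m"
    then show "l2norm {..<r} (L (part Q)) \<le> sqrt (1 + \<delta>) * L2_set b Q"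
      using upper[of Q] l2L2[of Q] by fastforce
  qed
  have split: "w i = part (T \<union> R) i + part (G - T - R) i" if "i \<in> I" for i
    using f[OF that] by (auto simp: part_def restrict_arr_def)
  have "l2norm I w = l2norm I (\<lambda>i. part (T \<union> R) i + part (G - T - R) i)"
    by (intro l2norm_cong split)
  then have total: "l2norm I w \<le> u + \<tau>"
    using l2norm_triangle[of I "part (T \<union> R)" "part (G - T - R)"] tail by (simp add: u_def)
  have "sqrt (1 - \<delta>) * u \<le> l2norm {..<r} (L (part (T \<union> R)))"
    unfolding u_def using T R card_Un_le[of T R] by (intro lower) auto
  also have "\<dots> = l2norm {..<r} (\<lambda>k. L w k - L (part (G - T - R)) k)"
  proof (rule l2norm_cong)
    fix j assume "j \<in> {..<r}"
    then have "j < r" by simp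
    \<comment> \<open>The two arguments agree on \<open>I\<close> only, since \<open>f\<close> need
      not map into \<open>G\<close> elsewhere; the locality clause of \<open>linear_op\<close>
      closes the gap.\<close>
    have "L (part (T \<union> R)) j = L (\<lambda>i. w i - part (G - T - R) i) j"
      by (rule linear_op_cong[OF lin \<open>j < r\<close>]) (simp add: split)
    then show "L (part (T \<union> R)) j = L w j - L (part (G - T - R)) j"
      by (simp add: linear_op_diff[OF lin \<open>j < r\<close>])
  qed
  also have "\<dots> \<le> l2norm {..<r} (L w) + sqrt (1 + \<delta>) * \<tau>"
    using l2norm_triangle_diff[of "{..<r}" "L w" "L (part (G - T - R))"] Ltail by simp
  finally have main: "sqrt (1 - \<delta>) * u \<le> l2norm {..<r} (L w) + sqrt (1 + \<delta>) * \<tau>" .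
  have "l2norm {i\<in>I. f i \<in> T} w \<le> u"
    unfolding u_def l2part unfolding l2norm_def using I
    by (intro real_sqrt_le_mono sum_mono2) auto
  from that[OF this main total] show thesis .
qed


subsection \<open>The Haar system on the grid\<close>

lemma finite_grid: "finite (grid d N)"
  by (simp add: grid_def finite_PiE)

lemma grid_ge_1: "\<alpha> \<in> grid d N \<Longrightarrow> i \<in> {1..d} \<Longrightarrow> 1 \<le> \<alpha> i"
  and grid_le: "\<alpha> \<in> grid d N \<Longrightarrow> i \<in> {1..d} \<Longrightarrow> \<alpha> i \<le> N"
  by (auto simp: grid_def PiE_iff)

lemma grid_upd: "\<alpha> \<in> grid d N \<Longrightarrow> i \<in> {1..d} \<Longrightarrow> 1 \<le> v \<Longrightarrow> v \<le> N \<Longrightarrow> \<alpha>(i := v) \<in> grid d N"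
  by (auto simp: grid_def PiE_iff extensional_def)

text \<open>On the sample points the conditions defining a Haar function become integer divisions; \<open>H\<close> is the
  half-length of the support.\<close>

lemma haar1_sample:
  fixes a k H :: nat
  assumes H: "0 < H"
  shows "haar1 e (real a / real (2 * H) - real k) =
    (if e = 0 then of_bool (a div H = 2 * k) + of_bool (a div H = 2 * k + 1)
     else of_bool (a div H = 2 * k) - of_bool (a div H = 2 * k + 1))"
proof -
  have div_eq: "a div H = j \<longleftrightarrow> j * H \<le> a \<and> a < (j + 1) * H" for j
    using H by (metis Suc_eq_plus1 div_nat_eqI dividend_less_times_div mult.commute
        mult_Suc_right times_div_less_eq_dividend add.commute)
  have lo: "0 \<le> real a / real (2 * H) - real k \<longleftrightarrow> 2 * k * H \<le> a"
  proof -
    have "0 \<le> real a / real (2 * H) - real k \<longleftrightarrow> real (2 * k * H) \<le> real a"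
      using H by (simp add: field_simps)
    then show ?thesis by (simp only: of_nat_le_iff)
  qed
  have mid: "real a / real (2 * H) - real k < 1/2 \<longleftrightarrow> a < (2 * k + 1) * H"
  proof -
    have "real a / real (2 * H) - real k < 1/2 \<longleftrightarrow> real a < real ((2 * k + 1) * H)"
      using H by (auto simp: field_simps)
    then show ?thesis by (simp only: of_nat_less_iff)
  qed
  have hi: "real a / real (2 * H) - real k < 1 \<longleftrightarrow> a < (2 * k + 1 + 1) * H"
  proof -
    have "real a / real (2 * H) - real k < 1 \<longleftrightarrow> real a < real ((2 * k + 1 + 1) * H)"
      using H by (simp add: field_simps)
    then show ?thesis by (simp only: of_nat_less_iff)
  qed
  have lohi: "0 \<le> t \<and> t < 1 \<longleftrightarrow> (0 \<le> t \<and> t < 1/2) \<or> (1/2 \<le> t \<and> t < 1)" for t :: real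
    by auto
  have mid': "1/2 \<le> real a / real (2 * H) - real k \<longleftrightarrow> (2 * k + 1) * H \<le> a"
    using mid by (meson not_less)
  have "(2 * k * H \<le> a \<and> a < (2 * k + 1) * H) \<longleftrightarrow> a div H = 2 * k"
    "((2 * k + 1) * H \<le> a \<and> a < (2 * k + 1 + 1) * H) \<longleftrightarrow> a div H = 2 * k + 1"
    by (simp_all add: div_eq)
  then have "indicator {0..<1/2} (real a / real (2 * H) - real k) = (of_bool (a div H = 2 * k) :: real)"
    "indicator {1/2..<1} (real a / real (2 * H) - real k) = (of_bool (a div H = 2 * k + 1) :: real)"
    "indicator {0..<1} (real a / real (2 * H) - real k) =
      (of_bool (a div H = 2 * k \<or> a div H = 2 * k + 1) :: real)"
    unfolding indicator_def atLeastLessThan_iff lohi unfolding lo mid mid' hi by (simp_all only:)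
  then show ?thesis by (simp add: haar1_def)
qed

text \<open>The one-dimensional factor h^e(2^j t - k) at the sample t = (a - 1)/2^n, for
  \<open>H = 2 ^ (n - Suc j)\<close>. The quotient numbers the half-supports from 0, and
  \<open>2 * k\<close>, \<open>2 * k + 1\<close> are the two halves of shift \<open>k\<close>. Type
  0 is written as a sum of two indicators so that both types expand in the same pair.\<close>

definition hfac :: "nat \<Rightarrow> nat \<Rightarrow> nat \<Rightarrow> nat \<Rightarrow> real" where
  "hfac H e k a = (if e = 0 then of_bool ((a - 1) div H = 2 * k) + of_bool ((a - 1) div H = 2 * k + 1)
     else of_bool ((a - 1) div H = 2 * k) - of_bool ((a - 1) div H = 2 * k + 1))"

lemma haar_wavelet_sample:
  assumes \<alpha>: "\<alpha> \<in> grid d (2 ^ n)" and j: "j < n"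
  shows "haar_wavelet d j k e (\<lambda>i. (real (\<alpha> i) - 1) / real (2 ^ n)) =
    2 powr (real (j * d) / 2) * (\<Prod>i=1..d. hfac (2 ^ (n - Suc j)) (e i) (k i) (\<alpha> i))"
proof -
  have "haar1 (e i) (2 ^ j * ((real (\<alpha> i) - 1) / real (2 ^ n)) - real (k i)) =
      hfac (2 ^ (n - Suc j)) (e i) (k i) (\<alpha> i)" if "i \<in> {1..d}" for i
  proof -
    have "(2::real) ^ n = 2 ^ j * (2 * 2 ^ (n - Suc j))"
      using j by (simp flip: power_add power_Suc)
    then have "2 ^ j * ((real (\<alpha> i) - 1) / real (2 ^ n)) = real (\<alpha> i - 1) / real (2 * 2 ^ (n - Suc j))"
      using grid_ge_1[OF \<alpha> that] by (simp add: of_nat_diff)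
    moreover have "(0::nat) < 2 ^ (n - Suc j)" by simp
    ultimately show ?thesis by (simp only: haar1_sample hfac_def)
  qed
  then show ?thesis by (simp add: haar_wavelet_def haar_fun_def)
qed

lemma sum_nat_halves:
  fixes b :: nat and g :: "nat \<Rightarrow> real"
  assumes "b < 2 * K"
  shows "(\<Sum>k<K. of_bool (b = 2 * k) * g (2 * k) + of_bool (b = 2 * k + 1) * g (2 * k + 1)) = g b"
proof -
  have "of_bool (b = 2 * k) * g (2 * k) + of_bool (b = 2 * k + 1) * g (2 * k + 1)
      = (if k = b div 2 then g b else 0)" for k
    by (cases "even b") (auto elim!: evenE oddE)
  then show ?thesis using assms by simp
qed

text \<open>With u, v the indicators of the two halves at \<open>a\<close> and u', v' those at
  \<open>b\<close>, (u + v)(u' + v') + (u - v)(u' - v') = 2(uu' + vv'). The cross terms cancel, and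
  what is left tests whether both points lie in the same half-support.\<close>

lemma sum_hfac_all:
  assumes "(a - 1) div H < 2 * K"
  shows "(\<Sum>k<K. \<Sum>e\<in>{0, 1}. hfac H e k a * hfac H e k b) = 2 * of_bool ((a - 1) div H = (b - 1) div H)"
proof -
  have "(\<Sum>k<K. \<Sum>e\<in>{0, 1}. hfac H e k a * hfac H e k b) =
     (\<Sum>k<K. of_bool ((a - 1) div H = 2 * k) * (2 * of_bool (2 * k = (b - 1) div H)) +
       of_bool ((a - 1) div H = 2 * k + 1) * (2 * of_bool (2 * k + 1 = (b - 1) div H)))"
    by (rule sum.cong) (auto simp: hfac_def of_bool_def)
  also have "\<dots> = 2 * of_bool ((a - 1) div H = (b - 1) div H)"
    by (rule sum_nat_halves[OF assms])
  finally show ?thesis .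
qed

lemma hfac_0: "hfac H 0 k a = of_bool ((a - 1) div H div 2 = k)"
  by (auto simp: hfac_def of_bool_def)

lemma abs_hfac: "\<bar>hfac H e k a\<bar> = of_bool ((a - 1) div H div 2 = k)"
  by (auto simp: hfac_def of_bool_def)

lemma sum_hfac_0:
  assumes "(a - 1) div H < 2 * K"
  shows "(\<Sum>k<K. hfac H 0 k a * hfac H 0 k b) = of_bool ((a - 1) div H div 2 = (b - 1) div H div 2)"
proof -
  have "(\<Sum>k<K. hfac H 0 k a * hfac H 0 k b) =
     (\<Sum>k<K. if k = (a - 1) div H div 2 then of_bool (k = (b - 1) div H div 2) else 0)"
    by (rule sum.cong) (auto simp: hfac_0 of_bool_def)
  also have "\<dots> = of_bool ((a - 1) div H div 2 = (b - 1) div H div 2)"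
    using assms by simp
  finally show ?thesis .
qed

lemma sum_abs_hfac: "(a - 1) div H < 2 * K \<Longrightarrow> (\<Sum>k<K. \<bar>hfac H e k a\<bar>) = 1"
  by (simp add: abs_hfac of_bool_def)

abbreviation haar_shifts :: "nat \<Rightarrow> nat \<Rightarrow> mindex set" where
  "haar_shifts d j \<equiv> {1..d} \<rightarrow>\<^sub>E {0..<2 ^ j}"

abbreviation haar_types :: "nat \<Rightarrow> mindex set" where
  "haar_types d \<equiv> {e \<in> {1..d} \<rightarrow>\<^sub>E {0, 1}. \<exists>i\<in>{1..d}. e i \<noteq> 0}"

lemma finite_shifts: "finite (haar_shifts d j)" and finite_types: "finite (haar_types d)"
  by (simp_all add: finite_PiE)

lemma sum_haar_index:
  fixes g :: "haar_label \<Rightarrow> 'b::comm_monoid_add"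
  shows "(\<Sum>a\<in>haar_index d n. g a) =
    g None + (\<Sum>j<n. \<Sum>k\<in>haar_shifts d j. \<Sum>e\<in>haar_types d. g (Some (j, k, e)))"
proof -
  define W where "W = Sigma {..<n} (\<lambda>j. haar_shifts d j \<times> haar_types d)"
  have W: "haar_index d n = insert None (Some ` W)"
    unfolding haar_index_def W_def by (intro arg_cong[of _ _ "insert None"] image_cong) auto
  have fin: "finite W" unfolding W_def by (intro finite_SigmaI finite_shifts finite_types finite_lessThan)
  have "(\<Sum>a\<in>haar_index d n. g a) = g None + (\<Sum>w\<in>W. g (Some w))"
    unfolding W using fin by (subst sum.insert) (auto simp: sum.reindex)
  also have "(\<Sum>w\<in>W. g (Some w)) = (\<Sum>j<n. \<Sum>(k, e)\<in>haar_shifts d j \<times> haar_types d. g (Some (j, k, e)))"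
  proof -
    have "finite (haar_shifts d j \<times> haar_types d)" for j
      by (intro finite_cartesian_product finite_shifts finite_types)
    then show ?thesis
      unfolding W_def by (subst sum.Sigma) (auto intro!: sum.cong)
  qed
  finally show ?thesis by (simp add: sum.cartesian_product)
qed

lemma finite_haar_index: "finite (haar_index d n)"
proof -
  have "haar_index d n \<subseteq> insert None (Some ` Sigma {..<n} (\<lambda>j. haar_shifts d j \<times> haar_types d))"
    unfolding haar_index_def by auto
  then show ?thesis
    by (rule finite_subset) (intro finite.insertI finite_imageI finite_SigmaI finite_shifts
        finite_types finite_lessThan)
qed

text \<open>The condition that some \<open>e i\<close> is nonzero prevents a sum over types from
  factorising over coordinates. Passing to all types and subtracting type 0 gives two sums that do
  factorise.\<close>

lemma sum_haar_types:
  fixes g :: "mindex \<Rightarrow> real"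
  shows "(\<Sum>e\<in>haar_types d. g e) = (\<Sum>e\<in>{1..d} \<rightarrow>\<^sub>E {0, 1}. g e) - g (\<lambda>i\<in>{1..d}. 0)"
proof -
  have eq: "({1..d} \<rightarrow>\<^sub>E {0, 1::nat}) = insert (\<lambda>i\<in>{1..d}. 0) (haar_types d)"
  proof (intro equalityI subsetI)
    fix e assume e: "e \<in> {1..d} \<rightarrow>\<^sub>E {0, 1::nat}"
    show "e \<in> insert (\<lambda>i\<in>{1..d}. 0) (haar_types d)"
    proof (cases "\<exists>i\<in>{1..d}. e i \<noteq> 0")
      case True
      then show ?thesis using e by auto
    next
      case False
      then have "e = (\<lambda>i\<in>{1..d}. 0)" using e by (intro ext) (auto simp: PiE_iff extensional_def)
      then show ?thesis by simp
    qed
  qed (auto simp: PiE_iff)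
  have "(\<lambda>i\<in>{1..d}. 0) \<notin> haar_types d" by auto
  from trans[OF arg_cong[OF eq, of "sum g"] sum.insert[OF finite_types this]]
  show ?thesis by simp
qed

lemma grid_div_less:
  assumes "\<alpha> \<in> grid d (2 ^ n)" "i \<in> {1..d}" "j < n"
  shows "(\<alpha> i - 1) div 2 ^ (n - Suc j) < 2 * 2 ^ j"
proof -
  have "2 * 2 ^ j * 2 ^ (n - Suc j) = (2::nat) ^ n"
    using assms(3) by (simp flip: power_add power_Suc)
  then have "\<alpha> i - 1 < 2 * 2 ^ j * 2 ^ (n - Suc j)"
    using grid_ge_1[OF assms(1,2)] grid_le[OF assms(1,2)] by simp
  then show ?thesis by (simp add: div_less_iff_less_mult)
qed

text \<open>The kernel of the projection onto the arrays that are constant on dyadic cubes of level \<open>j\<close>.\<close>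

definition dyadic_kernel :: "nat \<Rightarrow> nat \<Rightarrow> mindex \<Rightarrow> mindex \<Rightarrow> nat \<Rightarrow> real" where
  "dyadic_kernel d n \<alpha> \<beta> j =
     (\<Prod>i=1..d. 2 ^ j / 2 ^ n * of_bool ((\<alpha> i - 1) div 2 ^ (n - j) = (\<beta> i - 1) div 2 ^ (n - j)))"

lemma haar_level_kernel:
  fixes \<beta> :: mindex
  assumes \<alpha>: "\<alpha> \<in> grid d (2 ^ n)" and j: "j < n"
  defines "F \<equiv> \<lambda>k e. \<Prod>i=1..d. 2 ^ j / 2 ^ n *
    (hfac (2 ^ (n - Suc j)) (e i) (k i) (\<alpha> i) * hfac (2 ^ (n - Suc j)) (e i) (k i) (\<beta> i))"
  shows "(\<Sum>k\<in>haar_shifts d j. \<Sum>e\<in>haar_types d. F k e) =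
    dyadic_kernel d n \<alpha> \<beta> (Suc j) - dyadic_kernel d n \<alpha> \<beta> j"
proof -
  let ?H = "2 ^ (n - Suc j) :: nat"
  let ?r = "2 ^ j / 2 ^ n :: real"
  let ?h = "\<lambda>i k e. ?r * (hfac ?H e k (\<alpha> i) * hfac ?H e k (\<beta> i))"
  note lt = grid_div_less[OF \<alpha> _ j]
  have "(\<Sum>k\<in>haar_shifts d j. \<Sum>e\<in>{1..d} \<rightarrow>\<^sub>E {0, 1}. F k e) =
      (\<Sum>k\<in>haar_shifts d j. \<Prod>i=1..d. \<Sum>e\<in>{0, 1}. ?h i (k i) e)"
    unfolding F_def by (intro sum.cong refl prod_sum_PiE[symmetric]) auto
  also have "\<dots> = (\<Prod>i=1..d. \<Sum>k\<in>{0..<2 ^ j}. \<Sum>e\<in>{0, 1}. ?h i k e)"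
    by (intro prod_sum_PiE[symmetric]) auto
  also have "\<dots> = dyadic_kernel d n \<alpha> \<beta> (Suc j)"
    unfolding dyadic_kernel_def
  proof (intro prod.cong refl)
    fix i assume "i \<in> {1..d}"
    from sum_hfac_all[OF lt[OF this], of "\<beta> i"]
    show "(\<Sum>k\<in>{0..<2 ^ j}. \<Sum>e\<in>{0, 1}. ?h i k e) =
        2 ^ Suc j / 2 ^ n * of_bool ((\<alpha> i - 1) div ?H = (\<beta> i - 1) div ?H)"
      by (simp only: atLeast0LessThan flip: sum_distrib_left) simp
  qed
  finally have all: "(\<Sum>k\<in>haar_shifts d j. \<Sum>e\<in>{1..d} \<rightarrow>\<^sub>E {0, 1}. F k e) = dyadic_kernel d n \<alpha> \<beta> (Suc j)" .
  have "(\<Sum>k\<in>haar_shifts d j. F k (\<lambda>i\<in>{1..d}. 0)) = (\<Sum>k\<in>haar_shifts d j. \<Prod>i=1..d. ?h i (k i) 0)"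
    unfolding F_def by (intro sum.cong prod.cong) auto
  also have "\<dots> = (\<Prod>i=1..d. \<Sum>k\<in>{0..<2 ^ j}. ?h i k 0)"
    by (intro prod_sum_PiE[symmetric]) auto
  also have "\<dots> = dyadic_kernel d n \<alpha> \<beta> j"
    unfolding dyadic_kernel_def
  proof (intro prod.cong refl)
    fix i assume "i \<in> {1..d}"
    \<comment> \<open>Two half-supports of length \<open>?H\<close> make up one dyadic cell of level
      \<open>j\<close>.\<close>
    have "2 ^ (n - j) = ?H * 2"
      using Suc_diff_Suc[OF j] by (metis power_Suc2)
    then have "a div ?H div 2 = a div 2 ^ (n - j)" for a :: nat
      by (simp only: div_mult2_eq)
    then show "(\<Sum>k\<in>{0..<2 ^ j}. ?h i k 0) =
        ?r * of_bool ((\<alpha> i - 1) div 2 ^ (n - j) = (\<beta> i - 1) div 2 ^ (n - j))"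
      using sum_hfac_0[OF lt[OF \<open>i \<in> {1..d}\<close>], of "\<beta> i"]
      by (simp only: atLeast0LessThan flip: sum_distrib_left)
  qed
  finally have zero: "(\<Sum>k\<in>haar_shifts d j. F k (\<lambda>i\<in>{1..d}. 0)) = dyadic_kernel d n \<alpha> \<beta> j" .
  show ?thesis by (simp only: sum_haar_types sum_subtractf all zero)
qed

lemma powr_half_square: "0 < x \<Longrightarrow> x powr (real m / 2) * x powr (real m / 2) = x ^ m"
  by (simp add: powr_realpow flip: powr_add)

text \<open>Completeness by telescoping: the constant array contributes the kernel of level 0, where
  the whole grid is one cell; each scale adds one difference; and at level \<open>n\<close> the
  cells are single points.\<close>

lemma haar_kernel:
  assumes \<alpha>: "\<alpha> \<in> grid d (2 ^ n)" and \<beta>: "\<beta> \<in> grid d (2 ^ n)"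
  shows "(\<Sum>a\<in>haar_index d n. haar_array d (2 ^ n) a \<alpha> * cnj (haar_array d (2 ^ n) a \<beta>)) =
    of_bool (\<alpha> = \<beta>)"
proof -
  have N: "(2 ^ n) powr (- real d / 2) * (2 ^ n) powr (- real d / 2) = (\<Prod>i=1..d. (1 / 2 ^ n :: real))"
  proof -
    have "(2 ^ n) powr (- real d / 2) * (2 ^ n) powr (- real d / 2) = ((2::real) ^ n) powr (- real d)"
      by (subst powr_add[symmetric]) simp
    then show ?thesis by (simp add: powr_minus powr_realpow inverse_eq_divide power_divide)
  qed
  have None: "haar_array d (2 ^ n) None \<alpha> * cnj (haar_array d (2 ^ n) None \<beta>) =
      of_real (dyadic_kernel d n \<alpha> \<beta> 0)"
  proof -
    have "dyadic_kernel d n \<alpha> \<beta> 0 = (\<Prod>i=1..d. (1 / 2 ^ n :: real))"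
      unfolding dyadic_kernel_def
    proof (intro prod.cong refl)
      fix i assume "i \<in> {1..d}"
      then have "(\<alpha> i - 1) div 2 ^ n = 0" "(\<beta> i - 1) div 2 ^ n = 0"
        using grid_ge_1[OF \<alpha>, of i] grid_le[OF \<alpha>, of i] grid_ge_1[OF \<beta>, of i] grid_le[OF \<beta>, of i]
        by (auto intro!: div_less)
      then show "2 ^ 0 / 2 ^ n * of_bool ((\<alpha> i - 1) div 2 ^ (n - 0) = (\<beta> i - 1) div 2 ^ (n - 0)) =
          (1 / 2 ^ n :: real)" by simp
    qed
    then show ?thesis using N
      by (simp add: haar_array_def flip: of_real_mult)
  qed
  have Some: "haar_array d (2 ^ n) (Some (j, k, e)) \<alpha> * cnj (haar_array d (2 ^ n) (Some (j, k, e)) \<beta>) =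
      of_real (\<Prod>i=1..d. 2 ^ j / 2 ^ n *
        (hfac (2 ^ (n - Suc j)) (e i) (k i) (\<alpha> i) * hfac (2 ^ (n - Suc j)) (e i) (k i) (\<beta> i)))"
    if "j < n" for j k e
  proof -
    have J: "(2 powr (real (j * d) / 2)) * (2 powr (real (j * d) / 2)) = (\<Prod>i=1..d. (2 ^ j :: real))"
      by (subst powr_half_square) (simp_all add: power_mult)
    then have split: "((2 ^ n) powr (- real d / 2) * (2 powr (real (j * d) / 2) * P)) *
        ((2 ^ n) powr (- real d / 2) * (2 powr (real (j * d) / 2) * Q)) =
        (\<Prod>i=1..d. (1 / 2 ^ n :: real)) * (\<Prod>i=1..d. (2 ^ j :: real)) * (P * Q)" for P Q
      unfolding N[symmetric] J[symmetric] by (simp only: ac_simps)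
    then show ?thesis
      unfolding haar_array_def option.case prod.case complex_cnj_complex_of_real
        haar_wavelet_sample[OF \<alpha> that] haar_wavelet_sample[OF \<beta> that] of_real_mult[symmetric]
        of_real_eq_iff
      unfolding of_nat_power of_nat_numeral split
      by (simp only: prod.distrib[symmetric]) (simp add: mult_ac)
  qed
  have "(\<Sum>a\<in>haar_index d n. haar_array d (2 ^ n) a \<alpha> * cnj (haar_array d (2 ^ n) a \<beta>)) =
      of_real (dyadic_kernel d n \<alpha> \<beta> 0 +
        (\<Sum>j<n. dyadic_kernel d n \<alpha> \<beta> (Suc j) - dyadic_kernel d n \<alpha> \<beta> j))"
    unfolding sum_haar_index None of_real_add of_real_sum
    by (intro arg_cong2[of _ _ _ _ "(+)"] refl sum.cong)
      (simp add: Some haar_level_kernel[OF \<alpha>, symmetric])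
  also have "\<dots> = of_real (dyadic_kernel d n \<alpha> \<beta> n)"
    by (simp add: sum_lessThan_telescope)
  also have "dyadic_kernel d n \<alpha> \<beta> n = of_bool (\<alpha> = \<beta>)"
  proof (cases "\<alpha> = \<beta>")
    case True
    then show ?thesis by (simp add: dyadic_kernel_def)
  next
    case False
    then obtain i where i: "i \<in> {1..d}" "\<alpha> i \<noteq> \<beta> i"
      using \<alpha> \<beta> unfolding grid_def by (metis PiE_ext)
    then have "\<alpha> i - 1 \<noteq> \<beta> i - 1"
      using grid_ge_1[OF \<alpha> i(1)] grid_ge_1[OF \<beta> i(1)] by linarith
    then show ?thesis
      unfolding dyadic_kernel_def using i(1) False by (intro trans[OF prod_zero]) auto
  qed
  finally show ?thesis by simp
qed

lemma haar_adjoint_transform: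
  assumes \<alpha>: "\<alpha> \<in> grid d (2 ^ n)"
  shows "haar_adjoint d n (haar_transform d n x) \<alpha> = x \<alpha>"
proof -
  have "haar_adjoint d n (haar_transform d n x) \<alpha> =
      (\<Sum>\<beta>\<in>grid d (2 ^ n). x \<beta> *
        (\<Sum>a\<in>haar_index d n. haar_array d (2 ^ n) a \<alpha> * cnj (haar_array d (2 ^ n) a \<beta>)))"
    unfolding haar_adjoint_def haar_transform_def inner_on_def sum_distrib_right sum_distrib_left
    by (subst sum.swap) (simp add: mult_ac)
  also have "\<dots> = (\<Sum>\<beta>\<in>grid d (2 ^ n). if \<beta> = \<alpha> then x \<alpha> else 0)"
    by (intro sum.cong) (auto simp: haar_kernel[OF \<alpha>])
  also have "\<dots> = x \<alpha>" using \<alpha> finite_grid by simp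
  finally show ?thesis .
qed

text \<open>Parseval: moving one transform across the inner product turns it into the adjoint, which
  inverts the other.\<close>

lemma l2norm_haar_transform:
  "l2norm (haar_index d n) (haar_transform d n x) = l2norm (grid d (2 ^ n)) x"
proof -
  have inner_self: "inner_on I z z = complex_of_real (\<Sum>i\<in>I. (cmod (z i))\<^sup>2)" for I and z :: "'i \<Rightarrow> complex"
    by (simp add: inner_on_def complex_norm_square del: of_real_power)
  have "inner_on (haar_index d n) (haar_transform d n x) (haar_transform d n x) =
      inner_on (grid d (2 ^ n)) x x"
    unfolding inner_haar_transform unfolding inner_on_def
    by (intro sum.cong) (auto simp: haar_adjoint_transform)
  then have "(\<Sum>a\<in>haar_index d n. (cmod (haar_transform d n x a))\<^sup>2) =
      (\<Sum>\<alpha>\<in>grid d (2 ^ n). (cmod (x \<alpha>))\<^sup>2)"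
    unfolding inner_self of_real_eq_iff .
  then show ?thesis by (simp add: l2norm_def)
qed


subsection \<open>Haar coefficients and total variation\<close>

lemma norm_grad_le_block_norm: "i \<in> {1..d} \<Longrightarrow> cmod (w (\<alpha>, i)) \<le> block_norm d w \<alpha>"
  unfolding block_norm_def using norm_le_l2norm[of "{1..d}" i "\<lambda>i. w (\<alpha>, i)"] by simp

text \<open>For a fixed offset \<open>t\<close> the shift is injective, so each grid edge in
  direction \<open>i\<close> is counted at most once, and a single gradient entry is dominated by
  its block norm.\<close>

lemma sum_shifted_dir_deriv:
  assumes i: "i \<in> {1..d}" and X: "X \<subseteq> grid d N" and t: "\<And>\<alpha>. \<alpha> \<in> X \<Longrightarrow> \<alpha> i + t \<le> N - 1"
  shows "(\<Sum>\<alpha>\<in>X. cmod (dir_deriv i x (\<alpha>(i := \<alpha> i + t)))) \<le> TV2 d N x"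
proof -
  let ?sh = "\<lambda>\<alpha>::mindex. \<alpha>(i := \<alpha> i + t)"
  have inj: "inj_on ?sh X"
  proof (rule inj_onI)
    fix \<alpha> \<beta> assume eq: "?sh \<alpha> = ?sh \<beta>"
    show "\<alpha> = \<beta>"
    proof
      fix j show "\<alpha> j = \<beta> j" using fun_cong[OF eq, of j] by (cases "j = i") auto
    qed
  qed
  have sub: "?sh ` X \<subseteq> grid d N"
  proof
    fix \<beta> assume "\<beta> \<in> ?sh ` X"
    then obtain \<alpha> where \<alpha>: "\<alpha> \<in> X" "\<beta> = ?sh \<alpha>" by auto
    then have "\<alpha> \<in> grid d N" using X by auto
    then show "\<beta> \<in> grid d N"
      unfolding \<alpha>(2) using i t[OF \<alpha>(1)] grid_ge_1[of \<alpha> d N i] by (intro grid_upd) auto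
  qed
  have "(\<Sum>\<alpha>\<in>X. cmod (dir_deriv i x (?sh \<alpha>))) = (\<Sum>\<alpha>\<in>X. cmod (grad N x (?sh \<alpha>, i)))"
    using t by (intro sum.cong) (auto simp: grad_def)
  also have "\<dots> = (\<Sum>\<beta>\<in>?sh ` X. cmod (grad N x (\<beta>, i)))"
    by (simp add: sum.reindex[OF inj])
  also have "\<dots> \<le> (\<Sum>\<beta>\<in>?sh ` X. block_norm d (grad N x) \<beta>)"
    using i by (intro sum_mono norm_grad_le_block_norm)
  also have "\<dots> \<le> TV2 d N x"
    unfolding TV2_def norm12_def using sub finite_grid
    by (intro sum_mono2) (auto simp: block_norm_def l2norm_nonneg)
  finally show ?thesis .
qed

lemma norm_diff_le_sum_dir_deriv:
  "cmod (x \<alpha> - x (\<alpha>(i := \<alpha> i + H))) \<le> (\<Sum>t<H. cmod (dir_deriv i x (\<alpha>(i := \<alpha> i + t))))"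
proof -
  have "(\<Sum>t<H. dir_deriv i x (\<alpha>(i := \<alpha> i + t))) = x (\<alpha>(i := \<alpha> i + H)) - x \<alpha>"
    using sum_lessThan_telescope[of "\<lambda>t. x (\<alpha>(i := \<alpha> i + t))" H] by (simp add: dir_deriv_def)
  then show ?thesis by (metis norm_minus_commute norm_sum)
qed

lemma norm_haar_array_Some:
  assumes "\<alpha> \<in> grid d (2 ^ n)" and "j < n"
  shows "cmod (haar_array d (2 ^ n) (Some (j, k, e)) \<alpha>) =
    (2 ^ n) powr (- real d / 2) * 2 powr (real (j * d) / 2) *
      (\<Prod>i=1..d. \<bar>hfac (2 ^ (n - Suc j)) (e i) (k i) (\<alpha> i)\<bar>)"
  unfolding haar_array_def option.case prod.case norm_of_real haar_wavelet_sample[OF assms]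
  by (simp add: abs_mult abs_prod)

text \<open>The supports of one scale and type tile the grid, so exactly one shift contributes at
  \<open>\<alpha>\<close>, with modulus 2^(-(n-j)d/2). This is where d >= 2 enters: d/2 >= 1 lowers
  the exponent to -(n-j), enough to pay for the telescoped steps.\<close>

lemma sum_norm_haar_array:
  assumes \<alpha>: "\<alpha> \<in> grid d (2 ^ n)" and j: "j < n" and d: "2 \<le> d"
  shows "(\<Sum>k\<in>haar_shifts d j. cmod (haar_array d (2 ^ n) (Some (j, k, e)) \<alpha>)) \<le> 1 / 2 ^ (n - j)"
proof -
  have "(\<Sum>k\<in>haar_shifts d j. \<Prod>i=1..d. \<bar>hfac (2 ^ (n - Suc j)) (e i) (k i) (\<alpha> i)\<bar>) =
      (\<Prod>i=1..d. \<Sum>k\<in>{0..<2 ^ j}. \<bar>hfac (2 ^ (n - Suc j)) (e i) k (\<alpha> i)\<bar>)"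
    by (intro prod_sum_PiE[symmetric]) auto
  also have "\<dots> = 1"
    using sum_abs_hfac[OF grid_div_less[OF \<alpha> _ j]] by (intro prod.neutral) (simp add: atLeast0LessThan)
  finally have *: "(\<Sum>k\<in>haar_shifts d j. \<Prod>i=1..d. \<bar>hfac (2 ^ (n - Suc j)) (e i) (k i) (\<alpha> i)\<bar>) = 1" .
  have "(\<Sum>k\<in>haar_shifts d j. cmod (haar_array d (2 ^ n) (Some (j, k, e)) \<alpha>)) =
      (2 ^ n) powr (- real d / 2) * 2 powr (real (j * d) / 2)"
    unfolding norm_haar_array_Some[OF \<alpha> j] sum_distrib_left[symmetric] * by simp
  also have "\<dots> = 2 powr (- (real (n - j) * (real d / 2)))"
  proof -
    have "((2::real) ^ n) powr (- real d / 2) = 2 powr (real n * (- real d / 2))"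
      by (simp add: powr_powr flip: powr_realpow)
    moreover have "real n * (- real d / 2) + real (j * d) / 2 = - (real (n - j) * (real d / 2))"
      using j by (simp add: of_nat_diff field_simps)
    ultimately show ?thesis by (simp only: powr_add[symmetric])
  qed
  also have "\<dots> \<le> 2 powr (- real (n - j))"
  proof -
    have "real (n - j) * 1 \<le> real (n - j) * (real d / 2)" using d by (intro mult_left_mono) auto
    then show ?thesis by (intro powr_mono) auto
  qed
  also have "\<dots> = 1 / 2 ^ (n - j)"
    by (simp add: powr_minus powr_realpow inverse_eq_divide)
  finally show ?thesis .
qed

text \<open>
  In a direction \<open>i\<close> with \<open>e i \<noteq> 0\<close> the Haar array is antisymmetric under the shift by half of its
  support, so the coefficient is a sum of differences of \<open>x\<close> over \<open>H = 2^(n-j-1)\<close> steps.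
\<close>

lemma haar_transform_paired:
  assumes j: "j < n" and i: "i \<in> {1..d}" and e: "e i \<noteq> 0"
  defines "H \<equiv> 2 ^ (n - Suc j) :: nat"
  defines "X \<equiv> {\<alpha> \<in> grid d (2 ^ n). even ((\<alpha> i - 1) div H)}"
  shows "haar_transform d n x (Some (j, k, e)) =
    (\<Sum>\<alpha>\<in>X. (x \<alpha> - x (\<alpha>(i := \<alpha> i + H))) * cnj (haar_array d (2 ^ n) (Some (j, k, e)) \<alpha>))"
    and "\<And>\<alpha>. \<alpha> \<in> X \<Longrightarrow> \<alpha> i + H \<le> 2 ^ n"
proof -
  let ?h = "haar_array d (2 ^ n) (Some (j, k, e))"
  let ?sh = "\<lambda>\<alpha>::mindex. \<alpha>(i := \<alpha> i + H)"
  let ?Y = "{\<alpha> \<in> grid d (2 ^ n). odd ((\<alpha> i - 1) div H)}"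
  have H: "0 < H" by (simp add: H_def)
  have NH: "2 ^ n = 2 * 2 ^ j * H"
    using j unfolding H_def by (simp flip: power_add power_Suc)
  show le: "\<alpha> i + H \<le> 2 ^ n" if "\<alpha> \<in> X" for \<alpha>
  proof -
    have \<alpha>: "\<alpha> \<in> grid d (2 ^ n)" and ev: "even ((\<alpha> i - 1) div H)" using that by (auto simp: X_def)
    have "(\<alpha> i - 1) div H < 2 * 2 ^ j"
      using grid_div_less[OF \<alpha> i j] by (simp add: H_def)
    \<comment> \<open>An even number below an even bound stays below it after adding 1, so the
      second half of the support still lies in the grid.\<close>
    then have "(\<alpha> i - 1) div H + 1 < 2 * 2 ^ j"
      using ev by (elim evenE) simp
    then have "((\<alpha> i - 1) div H + 1 + 1) * H \<le> 2 * 2 ^ j * H"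
      by (intro mult_right_mono) auto
    moreover have "\<alpha> i - 1 < ((\<alpha> i - 1) div H + 1) * H"
      using dividend_less_div_times[OF H, of "\<alpha> i - 1"] by simp
    ultimately show ?thesis unfolding NH by (simp add: algebra_simps)
  qed
  have bij: "bij_betw ?sh X ?Y"
  proof (rule bij_betwI[where g = "\<lambda>\<alpha>. \<alpha>(i := \<alpha> i - H)"])
    show "?sh \<in> X \<rightarrow> ?Y"
    proof
      fix \<alpha> assume \<alpha>: "\<alpha> \<in> X"
      then have "\<alpha> \<in> grid d (2 ^ n)" "even ((\<alpha> i - 1) div H)" by (auto simp: X_def)
      moreover from this have "(\<alpha> i + H - 1) div H = (\<alpha> i - 1) div H + 1"
        using grid_ge_1[of \<alpha> d "2 ^ n" i] i H
        by (metis Nat.add_diff_assoc2 div_add_self2 not_gr_zero)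
      ultimately show "?sh \<alpha> \<in> ?Y"
        using le[OF \<alpha>] grid_ge_1[of \<alpha> d "2 ^ n" i] i by (auto intro!: grid_upd)
    qed
    show "(\<lambda>\<alpha>. \<alpha>(i := \<alpha> i - H)) \<in> ?Y \<rightarrow> X"
    proof
      fix \<alpha> assume "\<alpha> \<in> ?Y"
      then have \<alpha>: "\<alpha> \<in> grid d (2 ^ n)" and od: "odd ((\<alpha> i - 1) div H)" by auto
      \<comment> \<open>An odd quotient is positive, so subtracting \<open>H\<close> from
        \<open>\<alpha> i\<close> neither truncates nor leaves the grid.\<close>
      then have "(\<alpha> i - 1) div H \<noteq> 0" by (metis even_zero)
      then have ge: "H \<le> \<alpha> i - 1" using H by (simp add: div_eq_0_iff)
      then have "(\<alpha> i - 1) div H = (\<alpha> i - 1 - H) div H + 1"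
        using H by (metis le_div_geq Suc_eq_plus1)
      then have "even ((\<alpha> i - H - 1) div H)"
        using od by (simp add: diff_commute)
      then show "\<alpha>(i := \<alpha> i - H) \<in> X"
        unfolding X_def using \<alpha> ge H i grid_le[OF \<alpha> i] grid_ge_1[OF \<alpha> i] by (auto intro!: grid_upd)
    qed
    show "(?sh \<alpha>)(i := ?sh \<alpha> i - H) = \<alpha>" if "\<alpha> \<in> X" for \<alpha> by simp
    show "?sh (\<alpha>(i := \<alpha> i - H)) = \<alpha>" if "\<alpha> \<in> ?Y" for \<alpha>
    proof -
      have "(\<alpha> i - 1) div H \<noteq> 0" using that by (metis (mono_tags, lifting) even_zero mem_Collect_eq)
      then have "H \<le> \<alpha> i" using H by (simp add: div_eq_0_iff)
      then show ?thesis by simp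
    qed
  qed
  have anti: "?h (?sh \<alpha>) = - ?h \<alpha>" if "\<alpha> \<in> X" for \<alpha>
  proof -
    have \<alpha>: "\<alpha> \<in> grid d (2 ^ n)" and ev: "even ((\<alpha> i - 1) div H)" using that by (auto simp: X_def)
    have sh: "?sh \<alpha> \<in> grid d (2 ^ n)"
      using le[OF that] grid_ge_1[OF \<alpha> i] by (intro grid_upd \<alpha> i) auto
    have "(\<alpha> i + H - 1) div H = (\<alpha> i - 1) div H + 1"
      using grid_ge_1[OF \<alpha> i] H by (metis Nat.add_diff_assoc2 div_add_self2 not_gr_zero)
    \<comment> \<open>From an even cell the shift reaches the next odd cell, so
      \<open>2 * k i\<close> is exchanged with \<open>2 * k i + 1\<close>; both sides vanish when
      the cell belongs to another shift.\<close>
    then have fi: "hfac H (e i) (k i) (\<alpha> i + H) = - hfac H (e i) (k i) (\<alpha> i)"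
      using ev e by (auto simp: hfac_def of_bool_def double_not_eq_Suc_double Suc_double_not_eq_double elim!: evenE)
    have "(\<Prod>l=1..d. hfac H (e l) (k l) (?sh \<alpha> l)) =
        hfac H (e i) (k i) (\<alpha> i + H) * (\<Prod>l\<in>{1..d} - {i}. hfac H (e l) (k l) (\<alpha> l))"
      using i by (subst prod.remove[of _ i]) auto
    also have "\<dots> = - (\<Prod>l=1..d. hfac H (e l) (k l) (\<alpha> l))"
      unfolding fi using i by (subst (2) prod.remove[of _ i]) auto
    finally have prod: "(\<Prod>l=1..d. hfac H (e l) (k l) (?sh \<alpha> l)) = - (\<Prod>l=1..d. hfac H (e l) (k l) (\<alpha> l))" .
    have "haar_wavelet d j k e (\<lambda>l. (real (?sh \<alpha> l) - 1) / real (2 ^ n)) =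
        - haar_wavelet d j k e (\<lambda>l. (real (\<alpha> l) - 1) / real (2 ^ n))"
      unfolding haar_wavelet_sample[OF sh j] haar_wavelet_sample[OF \<alpha> j] H_def[symmetric] prod
      by (rule mult_minus_right)
    then show ?thesis
      by (simp only: haar_array_def option.case prod.case mult_minus_right of_real_minus)
  qed
  have "haar_transform d n x (Some (j, k, e)) = (\<Sum>\<alpha>\<in>X \<union> ?Y. x \<alpha> * cnj (?h \<alpha>))"
    unfolding haar_transform_def inner_on_def by (intro sum.cong) (auto simp: X_def)
  also have "\<dots> = (\<Sum>\<alpha>\<in>X. x \<alpha> * cnj (?h \<alpha>)) + (\<Sum>\<alpha>\<in>?Y. x \<alpha> * cnj (?h \<alpha>))"
    using finite_grid[of d "2 ^ n"] by (intro sum.union_disjoint) (auto simp: X_def)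
  also have "(\<Sum>\<alpha>\<in>?Y. x \<alpha> * cnj (?h \<alpha>)) = (\<Sum>\<alpha>\<in>X. x (?sh \<alpha>) * cnj (?h (?sh \<alpha>)))"
    by (rule sum.reindex_bij_betw[OF bij, symmetric])
  also have "\<dots> = (\<Sum>\<alpha>\<in>X. - (x (?sh \<alpha>) * cnj (?h \<alpha>)))"
    by (intro sum.cong) (auto simp: anti)
  finally show "haar_transform d n x (Some (j, k, e)) =
      (\<Sum>\<alpha>\<in>X. (x \<alpha> - x (?sh \<alpha>)) * cnj (?h \<alpha>))"
    by (simp add: left_diff_distrib sum_subtractf sum_negf)
qed

text \<open>The direction \<open>i\<close> and the set \<open>X\<close> depend on the scale and the
  type but not on the shift, so the sum over shifts can be taken first and costs 1/2^(n-j). Each of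
  the \<open>H\<close> offsets in the telescoped differences then costs one total variation, and
  H/2^(n-j) <= 1.\<close>

lemma sum_haar_coeffs_le_TV2:
  assumes d: "2 \<le> d" and j: "j < n" and e: "e \<in> haar_types d"
  shows "(\<Sum>k\<in>haar_shifts d j. cmod (haar_transform d n x (Some (j, k, e)))) \<le> TV2 d (2 ^ n) x"
proof -
  obtain i where i: "i \<in> {1..d}" "e i \<noteq> 0" using e by auto
  define H where "H = (2 ^ (n - Suc j) :: nat)"
  define X where "X = {\<alpha> \<in> grid d (2 ^ n). even ((\<alpha> i - 1) div H)}"
  note paired = haar_transform_paired[where i = i and e = e, OF j i, folded H_def, folded X_def]
  let ?D = "\<lambda>\<alpha>. x \<alpha> - x (\<alpha>(i := \<alpha> i + H))"
  have "(\<Sum>k\<in>haar_shifts d j. cmod (haar_transform d n x (Some (j, k, e)))) \<le>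
      (\<Sum>k\<in>haar_shifts d j. \<Sum>\<alpha>\<in>X. cmod (?D \<alpha>) * cmod (haar_array d (2 ^ n) (Some (j, k, e)) \<alpha>))"
    unfolding paired(1) by (intro sum_mono order_trans[OF norm_sum]) (simp add: norm_mult)
  also have "\<dots> = (\<Sum>\<alpha>\<in>X. cmod (?D \<alpha>) *
      (\<Sum>k\<in>haar_shifts d j. cmod (haar_array d (2 ^ n) (Some (j, k, e)) \<alpha>)))"
    by (subst sum.swap) (simp add: sum_distrib_left)
  also have "\<dots> \<le> (\<Sum>\<alpha>\<in>X. (\<Sum>t<H. cmod (dir_deriv i x (\<alpha>(i := \<alpha> i + t)))) * (1 / 2 ^ (n - j)))"
    by (intro sum_mono mult_mono norm_diff_le_sum_dir_deriv sum_norm_haar_array j d)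
      (auto simp: X_def intro!: sum_nonneg)
  also have "\<dots> = (\<Sum>t<H. \<Sum>\<alpha>\<in>X. cmod (dir_deriv i x (\<alpha>(i := \<alpha> i + t)))) / 2 ^ (n - j)"
    by (subst sum.swap) (simp flip: sum_divide_distrib)
  also have "\<dots> \<le> (\<Sum>t<H. TV2 d (2 ^ n) x) / 2 ^ (n - j)"
  proof (intro divide_right_mono sum_mono sum_shifted_dir_deriv i(1))
    fix t \<alpha> assume "t \<in> {..<H}" "\<alpha> \<in> X"
    then show "\<alpha> i + t \<le> 2 ^ n - 1" using paired(2)[of \<alpha>] by auto
  qed (auto simp: X_def)
  also have "\<dots> = TV2 d (2 ^ n) x * (real H / 2 ^ (n - j))" by simp
  also have "\<dots> \<le> TV2 d (2 ^ n) x * 1"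
  proof (rule mult_left_mono)
    have "H \<le> 2 ^ (n - j)" unfolding H_def by (intro power_increasing) auto
    then have "real H \<le> real (2 ^ (n - j))" by (simp only: of_nat_le_iff)
    then show "real H / 2 ^ (n - j) \<le> 1" by simp
  qed (simp add: TV2_def norm12_def block_norm_def l2norm_nonneg sum_nonneg)
  finally show ?thesis by simp
qed

text \<open>There are \<open>n\<close> scales and fewer than 2^d types. \<open>None\<close> is left
  out because a constant array has total variation 0 but a nonzero constant coefficient in
  general.\<close>

lemma haar_l1_le_TV2:
  assumes d: "2 \<le> d"
  shows "(\<Sum>a\<in>haar_index d n - {None}. cmod (haar_transform d n x a)) \<le> real n * 2 ^ d * TV2 d (2 ^ n) x"
proof -
  let ?c = "\<lambda>a. if a = None then 0 else cmod (haar_transform d n x a)"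
  have "(\<Sum>a\<in>haar_index d n - {None}. cmod (haar_transform d n x a)) = (\<Sum>a\<in>haar_index d n. ?c a)"
    using finite_haar_index by (intro sum.mono_neutral_cong_left) auto
  also have "\<dots> = (\<Sum>j<n. \<Sum>e\<in>haar_types d. \<Sum>k\<in>haar_shifts d j.
      cmod (haar_transform d n x (Some (j, k, e))))"
    unfolding sum_haar_index by (subst sum.swap) simp
  also have "\<dots> \<le> (\<Sum>j<n. \<Sum>e\<in>haar_types d. TV2 d (2 ^ n) x)"
    using d by (intro sum_mono sum_haar_coeffs_le_TV2) auto
  also have "\<dots> = real n * (real (card (haar_types d)) * TV2 d (2 ^ n) x)"
    by simp
  also have "\<dots> \<le> real n * (2 ^ d * TV2 d (2 ^ n) x)"
  proof (intro mult_left_mono mult_right_mono)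
    have "card (haar_types d) \<le> card ({1..d} \<rightarrow>\<^sub>E {0, 1::nat})"
      by (intro card_mono finite_PiE) auto
    also have "\<dots> = 2 ^ d" by (simp add: card_PiE numeral_2_eq_2)
    finally have "real (card (haar_types d)) \<le> real (2 ^ d)" by (simp only: of_nat_le_iff)
    then show "real (card (haar_types d)) \<le> 2 ^ d" by simp
  qed (simp_all add: TV2_def norm12_def block_norm_def l2norm_nonneg sum_nonneg)
  finally show ?thesis by (simp add: mult.assoc)
qed


subsection \<open>The strong Sobolev inequality\<close>

lemma linear_op_haar:
  assumes "linear_op (grid d (2 ^ n)) p A"
  shows "linear_op (haar_index d n) p (\<lambda>c. A (haar_adjoint d n c))"
proof -
  have add: "haar_adjoint d n (\<lambda>a. b a + c a) = (\<lambda>\<alpha>. haar_adjoint d n b \<alpha> + haar_adjoint d n c \<alpha>)"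
    and scale: "haar_adjoint d n (\<lambda>a. t * c a) = (\<lambda>\<alpha>. t * haar_adjoint d n c \<alpha>)" for b c t
    by (simp_all add: haar_adjoint_def fun_eq_iff distrib_right sum.distrib sum_distrib_left mult.assoc)
  have cong: "haar_adjoint d n b = haar_adjoint d n c" if "\<forall>a\<in>haar_index d n. b a = c a" for b c
    using that by (auto simp: haar_adjoint_def fun_eq_iff)
  show ?thesis
    unfolding linear_op_def
  proof (intro conjI allI impI)
    fix b c :: "haar_label \<Rightarrow> complex" and k t assume k: "k < p"
    show "A (haar_adjoint d n (\<lambda>a. b a + c a)) k = A (haar_adjoint d n b) k + A (haar_adjoint d n c) k"
      using assms k by (simp add: add linear_op_def)
    show "A (haar_adjoint d n (\<lambda>a. t * b a)) k = t * A (haar_adjoint d n b) k"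
      using assms k by (simp add: scale linear_op_def)
  next
    fix b c :: "haar_label \<Rightarrow> complex" and k assume "\<forall>a\<in>haar_index d n. b a = c a"
    then have "haar_adjoint d n b = haar_adjoint d n c" by (rule cong)
    then show "A (haar_adjoint d n b) k = A (haar_adjoint d n c) k" by simp
  qed
qed

text \<open>Blocks are single coefficients, the head is \<open>{None}\<close>, and groups have size
  \<open>d * s\<close>, so at most 1 + ds <= 2ds entries are tested at a time. The tail is the l1
  bound divided by sqrt(ds), which is weakened to sqrt(s).\<close>

theorem strong_Sobolev:
  assumes d: "2 \<le> d" and s: "1 \<le> s" and lin: "linear_op (grid d (2 ^ n)) p A"
    and rip: "RIP (haar_index d n) p (\<lambda>c. A (haar_adjoint d n c)) (2 * d * s) \<delta>"
  shows "l2norm (grid d (2 ^ n)) x \<le> l2norm {..<p} (A x) / sqrt (1 - \<delta>) +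
    (sqrt (1 + \<delta>) / sqrt (1 - \<delta>) + 1) * (real n * 2 ^ d * TV2 d (2 ^ n) x / sqrt (real s))"
proof -
  let ?c = "haar_transform d n x"
  let ?L = "\<lambda>c. A (haar_adjoint d n c)"
  let ?\<tau> = "real n * 2 ^ d * TV2 d (2 ^ n) x / sqrt (real s)"
  have \<delta>: "0 < \<delta>" "\<delta> < 1" using rip by (auto simp: RIP_def)
  have ds: "1 \<le> d * s" using d s by auto
  have single: "{i \<in> haar_index d n. i = g} = {g}" if "g \<in> haar_index d n" for g
    using that by auto
  have "\<tau> \<le> ?\<tau>" if "\<tau> = (\<Sum>g\<in>haar_index d n - {None}. l2norm {i\<in>haar_index d n. i = g} ?c) / sqrt (real (d * s))" for \<tau>
  proof -
    have "\<tau> = (\<Sum>a\<in>haar_index d n - {None}. cmod (?c a)) / sqrt (real (d * s))"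
      unfolding that by (intro arg_cong2[of _ _ _ _ "(/)"] refl sum.cong) (simp add: single l2norm_def)
    also have "\<dots> \<le> (real n * 2 ^ d * TV2 d (2 ^ n) x) / sqrt (real (d * s))"
      by (intro divide_right_mono haar_l1_le_TV2 d) simp
    also have "\<dots> \<le> ?\<tau>"
    proof (rule divide_left_mono)
      show "sqrt (real s) \<le> sqrt (real (d * s))" using d mult_right_mono[of 1 "real d" "real s"] by simp
    qed (use s d in \<open>simp_all add: TV2_def norm12_def block_norm_def l2norm_nonneg sum_nonneg\<close>)
    finally show ?thesis .
  qed
  moreover obtain u \<tau> where \<tau>: "\<tau> = (\<Sum>g\<in>haar_index d n - {None}. l2norm {i\<in>haar_index d n. i = g} ?c) / sqrt (real (d * s))"
    and u: "sqrt (1 - \<delta>) * u \<le> l2norm {..<p} (?L ?c) + sqrt (1 + \<delta>) * \<tau>"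
      "l2norm (haar_index d n) ?c \<le> u + \<tau>"
  proof (rule RIP_block_bound[where f = "\<lambda>i. i" and T = "{None}" and m = "d * s" and D = 1 and w = ?c
        and G = "haar_index d n", OF finite_haar_index finite_haar_index _ linear_op_haar[OF lin] rip _ _ ds])
    show "1 * (card {None :: haar_label} + d * s) \<le> 2 * d * s" using ds by simp
    show "card {i \<in> haar_index d n. i = g} \<le> 1" if "g \<in> haar_index d n" for g
      by (simp add: single[OF that])
    show "{None} \<subseteq> haar_index d n" by (simp add: haar_index_def)
  qed auto
  ultimately have le: "\<tau> \<le> ?\<tau>" by blast
  have LA: "l2norm {..<p} (?L ?c) = l2norm {..<p} (A x)"
    by (intro l2norm_cong linear_op_cong[OF lin]) (auto simp: haar_adjoint_transform)
  have sq: "0 < sqrt (1 - \<delta>)" using \<delta> by simp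
  have "sqrt (1 - \<delta>) * u \<le> l2norm {..<p} (A x) + sqrt (1 + \<delta>) * ?\<tau>"
    using u(1) mult_left_mono[OF le, of "sqrt (1 + \<delta>)"] \<delta> unfolding LA by simp
  then have "u \<le> (l2norm {..<p} (A x) + sqrt (1 + \<delta>) * ?\<tau>) / sqrt (1 - \<delta>)"
    using sq by (simp add: pos_le_divide_eq mult.commute)
  then have "l2norm (grid d (2 ^ n)) x \<le> (l2norm {..<p} (A x) + sqrt (1 + \<delta>) * ?\<tau>) / sqrt (1 - \<delta>) + ?\<tau>"
    using u(2) le unfolding l2norm_haar_transform by linarith
  also have "\<dots> = l2norm {..<p} (A x) / sqrt (1 - \<delta>) + (sqrt (1 + \<delta>) / sqrt (1 - \<delta>) + 1) * ?\<tau>"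
    by (simp only: add_divide_distrib distrib_right times_divide_eq_left mult_1_left add.assoc)
  finally show ?thesis .
qed


subsection \<open>Stacked measurements\<close>

text \<open>Moving along \<open>l\<close> maps the edges bijectively onto the points with
  \<open>\<alpha> l \<noteq> 1\<close>. After this reindexing \<open>pad_first\<close> pairs each
  entry of \<open>b\<close> with the upper end point of its edge, and \<open>pad_last\<close> pairs
  it with the lower one.\<close>

lemma inner_pad_difference:
  assumes l: "l \<in> {1..d}" and N: "2 \<le> N"
  shows "inner_on (grid d N) x (pad_first l b) - inner_on (grid d N) x (pad_last N l b) =
    inner_on (edge_grid d N l) (dir_deriv l x) b"
proof -
  have fin: "finite (grid d N)" by (rule finite_grid)
  have bij: "bij_betw (\<lambda>\<alpha>. \<alpha>(l := \<alpha> l + 1)) (edge_grid d N l) {\<alpha> \<in> grid d N. \<alpha> l \<noteq> 1}"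
  proof (rule bij_betwI[where g = "\<lambda>\<alpha>. \<alpha>(l := \<alpha> l - 1)"])
    show "(\<lambda>\<alpha>. \<alpha>(l := \<alpha> l + 1)) \<in> edge_grid d N l \<rightarrow> {\<alpha> \<in> grid d N. \<alpha> l \<noteq> 1}"
      using l N grid_ge_1[of _ d N l] by (fastforce simp: edge_grid_def intro!: grid_upd)
    show "(\<lambda>\<alpha>. \<alpha>(l := \<alpha> l - 1)) \<in> {\<alpha> \<in> grid d N. \<alpha> l \<noteq> 1} \<rightarrow> edge_grid d N l"
    proof
      fix \<alpha> assume "\<alpha> \<in> {\<alpha> \<in> grid d N. \<alpha> l \<noteq> 1}"
      then have "\<alpha> \<in> grid d N" "\<alpha> l \<noteq> 1" by auto
      then show "\<alpha>(l := \<alpha> l - 1) \<in> edge_grid d N l"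
        using grid_ge_1[of \<alpha> d N l] grid_le[of \<alpha> d N l] l
        by (auto simp: edge_grid_def intro!: grid_upd)
    qed
    show "(\<alpha>(l := \<alpha> l - 1))(l := (\<alpha>(l := \<alpha> l - 1)) l + 1) = \<alpha>" if "\<alpha> \<in> {\<alpha> \<in> grid d N. \<alpha> l \<noteq> 1}" for \<alpha>
      using that grid_ge_1[of \<alpha> d N l] l by auto
  qed auto
  have "inner_on (grid d N) x (pad_first l b) =
      (\<Sum>\<alpha>\<in>{\<alpha> \<in> grid d N. \<alpha> l \<noteq> 1}. x \<alpha> * cnj (b (\<alpha>(l := \<alpha> l - 1))))"
    unfolding inner_on_def using fin
    by (intro sum.mono_neutral_cong_right) (auto simp: pad_first_def)
  also have "\<dots> = (\<Sum>\<alpha>\<in>edge_grid d N l. x (\<alpha>(l := \<alpha> l + 1)) * cnj (b \<alpha>))"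
    by (subst sum.reindex_bij_betw[OF bij, symmetric]) simp
  finally have first: "inner_on (grid d N) x (pad_first l b) =
      (\<Sum>\<alpha>\<in>edge_grid d N l. x (\<alpha>(l := \<alpha> l + 1)) * cnj (b \<alpha>))" .
  have eg: "edge_grid d N l = {\<alpha> \<in> grid d N. \<alpha> l \<noteq> N}"
    using grid_le[OF _ l, of _ N] N by (fastforce simp: edge_grid_def)
  have "inner_on (grid d N) x (pad_last N l b) = (\<Sum>\<alpha>\<in>edge_grid d N l. x \<alpha> * cnj (b \<alpha>))"
    unfolding inner_on_def eg using fin
    by (intro sum.mono_neutral_cong_right) (auto simp: pad_last_def)
  then show ?thesis
    unfolding first by (simp add: inner_on_def dir_deriv_def left_diff_distrib sum_subtractf)
qed

lemma op_pad_difference: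
  assumes l: "l \<in> {1..d}" and N: "2 \<le> N" and lin: "linear_op (edge_grid d N l) q L" and k: "k < q"
  shows "op_pad_first d N l L x k - op_pad_last d N l L x k = L (dir_deriv l x) k"
proof -
  have "finite (edge_grid d N l)" using finite_grid by (simp add: edge_grid_def)
  from op_of_arrays_of_op[OF this lin k, of "dir_deriv l x"] show ?thesis
    by (simp add: op_pad_first_def op_pad_last_def op_of_arrays_def inner_pad_difference[OF l N])
qed

lemma stacked_op_A: "k < p \<Longrightarrow> stacked_op d N p q A B x k = A x k"
  by (simp add: stacked_op_def)

lemma stacked_op_first:
  "r < q \<Longrightarrow> stacked_op d N p q A B x (p + (2 * q * j + r)) = op_pad_first d N (j + 1) (B (j + 1)) x r"
  by (simp add: stacked_op_def)

lemma stacked_op_last: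
  assumes "r < q"
  shows "stacked_op d N p q A B x (p + (2 * q * j + (q + r))) = op_pad_last d N (j + 1) (B (j + 1)) x r"
proof -
  have "(2 * q * j + (q + r)) div (2 * q) = j" "(2 * q * j + (q + r)) mod (2 * q) = q + r"
    using assms by simp_all
  then show ?thesis by (simp add: stacked_op_def)
qed

text \<open>The index arithmetic follows \<open>stacked_op\<close>: the outputs for direction
  \<open>j + 1\<close> start at \<open>p + 2 * q * j\<close>, and those of the second padding are
  offset by \<open>q\<close>.\<close>

lemma sum_stacked_outputs:
  fixes g :: "nat \<Rightarrow> real"
  shows "(\<Sum>k<2 * d * q + p. g k) = (\<Sum>k<p. g k) +
    (\<Sum>j<d. \<Sum>r<q. g (p + (2 * q * j + r)) + g (p + (2 * q * j + (q + r))))"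
proof -
  have split: "(\<Sum>k<a + b. h k) = (\<Sum>k<a. h k) + (\<Sum>k<b. h (a + k))" for a b and h :: "nat \<Rightarrow> real"
    by (induction b) simp_all
  have "(\<Sum>k<2 * d * q + p. g k) = (\<Sum>k<p. g k) + (\<Sum>k<d * (2 * q). g (p + k))"
    using split[of g p "2 * d * q"] by (simp add: ac_simps)
  also have "(\<Sum>k<d * (2 * q). g (p + k)) = (\<Sum>j<d. \<Sum>r<q + q. g (p + (2 * q * j + r)))"
  proof (induction d)
    case (Suc d)
    have "(\<Sum>k<Suc d * (2 * q). g (p + k)) =
        (\<Sum>k<d * (2 * q). g (p + k)) + (\<Sum>r<2 * q. g (p + (d * (2 * q) + r)))"
      by (subst split[symmetric]) (simp add: add.commute)
    also have "(\<Sum>r<2 * q. g (p + (d * (2 * q) + r))) = (\<Sum>r<q + q. g (p + (2 * q * d + r)))"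
      by (simp only: mult_2 mult.commute[of d])
    finally show ?case unfolding Suc.IH by simp
  qed simp
  finally show ?thesis by (simp add: split sum.distrib)
qed

lemma stacked_op_diff:
  assumes A: "linear_op (grid d N) p A"
  shows "stacked_op d N p q A B (\<lambda>i. x i - z i) k = stacked_op d N p q A B x k - stacked_op d N p q A B z k"
proof -
  have "op_of_arrays I b (\<lambda>i. x i - z i) r = op_of_arrays I b x r - op_of_arrays I b z r" for I b r
    by (simp add: op_of_arrays_def inner_on_def left_diff_distrib sum_subtractf)
  then show ?thesis
    by (simp add: stacked_op_def op_pad_first_def op_pad_last_def Let_def linear_op_diff[OF A])
qed

lemma linear_op_col_dsum:
  assumes "\<forall>l\<in>{1..d}. linear_op (edge_grid d N l) q (B l)"
  shows "linear_op (dsum_index d N) q (col_dsum d B)"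
  unfolding linear_op_def
proof (intro conjI allI impI)
  fix x y :: "nat \<times> mindex \<Rightarrow> complex" and k c assume k: "k < q"
  show "col_dsum d B (\<lambda>i. x i + y i) k = col_dsum d B x k + col_dsum d B y k"
    using assms k by (simp add: col_dsum_def linear_op_def flip: sum.distrib)
  show "col_dsum d B (\<lambda>i. c * x i) k = c * col_dsum d B x k"
    using assms k by (simp add: col_dsum_def linear_op_def sum_distrib_left)
next
  fix x y :: "nat \<times> mindex \<Rightarrow> complex" and k
  assume eq: "\<forall>i\<in>dsum_index d N. x i = y i" and k: "k < q"
  show "col_dsum d B x k = col_dsum d B y k"
    unfolding col_dsum_def
  proof (intro sum.cong refl)
    fix l assume l: "l \<in> {1..d}"
    show "B l (\<lambda>\<alpha>. x (l, \<alpha>)) k = B l (\<lambda>\<alpha>. y (l, \<alpha>)) k"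
    proof (rule linear_op_cong[OF bspec[OF assms l] k])
      fix \<alpha> assume "\<alpha> \<in> edge_grid d N l"
      with l have "(l, \<alpha>) \<in> dsum_index d N" by (simp add: dsum_index_def)
      with eq show "x (l, \<alpha>) = y (l, \<alpha>)" by blast
    qed
  qed
qed

text \<open>Each output of \<open>col_dsum\<close> is a signed sum of 2d outputs of the stacked
  operator, two for each direction. Cauchy-Schwarz gives the factor 2d, and different rows use
  disjoint sets of outputs.\<close>

lemma stacked_op_controls_derivatives:
  assumes N: "2 \<le> N" and B: "\<forall>l\<in>{1..d}. linear_op (edge_grid d N l) q (B l)"
  shows "l2norm {..<q} (col_dsum d B (\<lambda>(l, \<alpha>). dir_deriv l x \<alpha>)) \<le>
    sqrt (2 * real d) * l2norm {..<2 * d * q + p} (stacked_op d N p q A B x)"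
proof -
  let ?M = "stacked_op d N p q A B x"
  let ?f = "\<lambda>j r. ?M (p + (2 * q * j + r))" and ?g = "\<lambda>j r. ?M (p + (2 * q * j + (q + r)))"
  have row: "(cmod (col_dsum d B (\<lambda>(l, \<alpha>). dir_deriv l x \<alpha>) r))\<^sup>2 \<le>
      2 * real d * (\<Sum>j<d. (cmod (?f j r))\<^sup>2 + (cmod (?g j r))\<^sup>2)" if r: "r < q" for r
  proof -
    have "col_dsum d B (\<lambda>(l, \<alpha>). dir_deriv l x \<alpha>) r = (\<Sum>l=1..d. B l (dir_deriv l x) r)"
      by (simp add: col_dsum_def)
    also have "\<dots> = (\<Sum>j<d. B (Suc j) (dir_deriv (Suc j) x) r)"
      by (rule sum.reindex_bij_witness[of _ Suc "\<lambda>l. l - 1"]) auto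
    also have "\<dots> = (\<Sum>j<d. ?f j r - ?g j r)"
    proof (intro sum.cong refl)
      fix j assume "j \<in> {..<d}"
      then have j: "j + 1 \<in> {1..d}" by simp
      show "B (Suc j) (dir_deriv (Suc j) x) r = ?f j r - ?g j r"
        using op_pad_difference[OF j N bspec[OF B j] r, of x]
        by (simp add: stacked_op_first[OF r] stacked_op_last[OF r])
    qed
    finally have "cmod (col_dsum d B (\<lambda>(l, \<alpha>). dir_deriv l x \<alpha>) r) \<le> (\<Sum>j<d. cmod (?f j r - ?g j r))"
      by (simp add: norm_sum)
    then have "(cmod (col_dsum d B (\<lambda>(l, \<alpha>). dir_deriv l x \<alpha>) r))\<^sup>2 \<le> (\<Sum>j<d. cmod (?f j r - ?g j r))\<^sup>2"
      by (rule power_mono) simp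
    also have "\<dots> \<le> (\<Sum>j<d. (cmod (?f j r - ?g j r))\<^sup>2) * real d"
      using sum_squared_le_sum_of_squares[of "\<lambda>j. cmod (?f j r - ?g j r)" "{..<d}"] by simp
    also have "\<dots> \<le> (\<Sum>j<d. 2 * ((cmod (?f j r))\<^sup>2 + (cmod (?g j r))\<^sup>2)) * real d"
    proof (intro mult_right_mono sum_mono)
      fix j
      have "(cmod (?f j r - ?g j r))\<^sup>2 \<le> (cmod (?f j r) + cmod (?g j r))\<^sup>2"
        by (intro power_mono norm_triangle_ineq4) simp
      also have "\<dots> \<le> 2 * ((cmod (?f j r))\<^sup>2 + (cmod (?g j r))\<^sup>2)"
        using zero_le_power2[of "cmod (?f j r) - cmod (?g j r)"]
        by (simp add: power2_eq_square algebra_simps)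
      finally show "(cmod (?f j r - ?g j r))\<^sup>2 \<le> 2 * ((cmod (?f j r))\<^sup>2 + (cmod (?g j r))\<^sup>2)" .
    qed simp
    finally show ?thesis unfolding sum_distrib_left[symmetric] by (simp only: mult_ac)
  qed
  have "(\<Sum>r<q. (cmod (col_dsum d B (\<lambda>(l, \<alpha>). dir_deriv l x \<alpha>) r))\<^sup>2) \<le>
      (\<Sum>r<q. 2 * real d * (\<Sum>j<d. (cmod (?f j r))\<^sup>2 + (cmod (?g j r))\<^sup>2))"
    by (intro sum_mono row) simp
  also have "\<dots> = 2 * real d * (\<Sum>j<d. \<Sum>r<q. (cmod (?f j r))\<^sup>2 + (cmod (?g j r))\<^sup>2)"
    by (subst sum.swap) (simp add: sum_distrib_left)
  also have "\<dots> \<le> 2 * real d * (\<Sum>k<2 * d * q + p. (cmod (?M k))\<^sup>2)"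
    unfolding sum_stacked_outputs by (intro mult_left_mono) (simp_all add: sum_nonneg)
  finally show ?thesis
    unfolding l2norm_def real_sqrt_mult[symmetric] by (rule real_sqrt_le_mono)
qed


subsection \<open>Recovery\<close>

lemma block_norm_nonneg: "0 \<le> block_norm d w \<alpha>"
  by (simp add: block_norm_def l2norm_nonneg)

lemma grad_diff: "grad N (\<lambda>\<alpha>. x \<alpha> - z \<alpha>) i = grad N x i - grad N z i"
  by (cases i) (simp add: grad_def dir_deriv_def)

text \<open>Bridge between two index sets: \<open>grad\<close> has d entries at every grid point,
  while the domain of the direct sum has only genuine edges, with the pair in the other order. The
  surplus entries of \<open>grad\<close> are its boundary zeros.\<close>

lemma l2norm_grad_eq_dsum:
  assumes "2 \<le> N" and "K \<subseteq> grid d N"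
  shows "l2norm {i \<in> dsum_index d N. snd i \<in> K} (\<lambda>(l, \<alpha>). dir_deriv l x \<alpha>) =
    l2norm (K \<times> {1..d}) (grad N x)"
proof -
  have fin: "finite K" using finite_grid assms(2) finite_subset by blast
  have bij: "bij_betw prod.swap {i \<in> dsum_index d N. snd i \<in> K}
      {i \<in> K \<times> {1..d}. fst i (snd i) \<le> N - 1}"
    using assms(2) by (intro bij_betwI[where g = prod.swap]) (auto simp: dsum_index_def edge_grid_def)
  have "(\<Sum>i\<in>{i \<in> dsum_index d N. snd i \<in> K}. (cmod (case i of (l, \<alpha>) \<Rightarrow> dir_deriv l x \<alpha>))\<^sup>2) =
      (\<Sum>i\<in>{i \<in> dsum_index d N. snd i \<in> K}. (cmod (grad N x (prod.swap i)))\<^sup>2)"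
    by (intro sum.cong) (auto simp: dsum_index_def edge_grid_def grad_def)
  also have "\<dots> = (\<Sum>i\<in>{i \<in> K \<times> {1..d}. fst i (snd i) \<le> N - 1}. (cmod (grad N x i))\<^sup>2)"
    by (rule sum.reindex_bij_betw[OF bij])
  also have "\<dots> = (\<Sum>i\<in>K \<times> {1..d}. (cmod (grad N x i))\<^sup>2)"
    using fin by (intro sum.mono_neutral_left) (auto simp: grad_def split: if_splits)
  finally show ?thesis by (simp add: l2norm_def)
qed

lemma l2norm_product_eq_L2_set:
  assumes "finite K"
  shows "l2norm (K \<times> {1..d}) w = L2_set (block_norm d w) K"
  using assms by (simp add: L2_set_def block_norm_def l2norm_power2 sum.cartesian_product)
    (simp add: l2norm_def)

lemma sum_le_sqrt_card_L2_set:
  fixes b :: "'a \<Rightarrow> real"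
  shows "(\<Sum>g\<in>T. b g) \<le> sqrt (real (card T)) * L2_set b T"
proof -
  have "(\<Sum>g\<in>T. b g)\<^sup>2 \<le> real (card T) * (\<Sum>g\<in>T. (b g)\<^sup>2)"
    using sum_squared_le_sum_of_squares[of b T] by (simp add: mult.commute)
  then show ?thesis
    unfolding L2_set_def real_sqrt_mult[symmetric] by (rule real_le_rsqrt)
qed

text \<open>With w the gradient of the difference, the block norms of grad z are at least |grad x| -
  |w| on \<open>T\<close> and at least |w| - |grad x| off \<open>T\<close>. Summing and comparing
  with the total variation of \<open>x\<close> cancels the part of grad x on \<open>T\<close> and
  leaves its part off \<open>T\<close> twice.\<close>

lemma TV_cone_constraint:
  assumes T: "T \<subseteq> grid d N" and le: "TV2 d N z \<le> TV2 d N x"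
  shows "(\<Sum>\<alpha>\<in>grid d N - T. block_norm d (grad N (\<lambda>\<alpha>. x \<alpha> - z \<alpha>)) \<alpha>) \<le>
    (\<Sum>\<alpha>\<in>T. block_norm d (grad N (\<lambda>\<alpha>. x \<alpha> - z \<alpha>)) \<alpha>) +
    2 * (\<Sum>\<alpha>\<in>grid d N - T. block_norm d (grad N x) \<alpha>)"
proof -
  let ?w = "grad N (\<lambda>\<alpha>. x \<alpha> - z \<alpha>)"
  have w: "?w i = grad N x i - grad N z i" for i by (rule grad_diff)
  have out: "block_norm d ?w \<alpha> \<le> block_norm d (grad N x) \<alpha> + block_norm d (grad N z) \<alpha>" for \<alpha>
    unfolding block_norm_def w by (rule l2norm_triangle_diff)
  have ins: "block_norm d (grad N x) \<alpha> \<le> block_norm d ?w \<alpha> + block_norm d (grad N z) \<alpha>" for \<alpha>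
    using l2norm_triangle[of "{1..d}" "\<lambda>l. ?w (\<alpha>, l)" "\<lambda>l. grad N z (\<alpha>, l)"]
    by (simp add: block_norm_def w)
  have split: "TV2 d N y = (\<Sum>\<alpha>\<in>grid d N - T. block_norm d (grad N y) \<alpha>) +
      (\<Sum>\<alpha>\<in>T. block_norm d (grad N y) \<alpha>)" for y
    unfolding TV2_def norm12_def by (rule sum.subset_diff[OF T finite_grid])
  have "(\<Sum>\<alpha>\<in>grid d N - T. block_norm d ?w \<alpha>) \<le>
      (\<Sum>\<alpha>\<in>grid d N - T. block_norm d (grad N x) \<alpha> + block_norm d (grad N z) \<alpha>)"
    by (intro sum_mono out)
  moreover have "(\<Sum>\<alpha>\<in>T. block_norm d (grad N x) \<alpha>) \<le>
      (\<Sum>\<alpha>\<in>T. block_norm d ?w \<alpha> + block_norm d (grad N z) \<alpha>)"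
    by (intro sum_mono ins)
  ultimately show ?thesis using le by (simp add: sum.distrib split)
qed

text \<open>The constants leave room since \<open>\<surd>(1-\<delta>) - \<surd>(1+\<delta>)/2 > 1/5\<close> for \<open>\<delta> < 1/3\<close>.\<close>

lemma gradient_recovery:
  fixes \<sigma> E :: real
  assumes N: "2 \<le> N" and s: "1 \<le> s"
    and B: "\<forall>l\<in>{1..d}. linear_op (edge_grid d N l) q (B l)"
    and rip: "RIP (dsum_index d N) q (col_dsum d B) (5 * d * s) \<delta>" and \<delta>: "\<delta> < 1 / 3"
    and T: "T \<subseteq> grid d N" "card T \<le> s"
    and cone: "(\<Sum>\<alpha>\<in>grid d N - T. block_norm d (grad N v) \<alpha>) \<le>
      (\<Sum>\<alpha>\<in>T. block_norm d (grad N v) \<alpha>) + 2 * \<sigma>"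
    and tube: "l2norm {..<q} (col_dsum d B (\<lambda>(l, \<alpha>). dir_deriv l v \<alpha>)) \<le> E"
    and \<sigma>: "0 \<le> \<sigma>"
  shows "l2norm (grid d N \<times> {1..d}) (grad N v) \<le> 15/2 * E + 11 * (\<sigma> / sqrt (real s))"
    and "TV2 d N v \<le> 10 * sqrt (real s) * E + 14 * \<sigma>"
proof -
  define w where "w = (\<lambda>(l, \<alpha>). dir_deriv l v \<alpha>)"
  define b where "b = block_norm d (grad N v)"
  define \<tau> where "\<tau> = (\<Sum>\<alpha>\<in>grid d N - T. l2norm {i \<in> dsum_index d N. snd i = \<alpha>} w) / sqrt (real (4 * s))"
  have finT: "finite T" using T(1) finite_grid finite_subset by blast
  have \<delta>0: "0 < \<delta>" using rip by (simp add: RIP_def)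
  have block: "l2norm {i \<in> dsum_index d N. snd i = \<alpha>} w = b \<alpha>" if "\<alpha> \<in> grid d N" for \<alpha>
    using l2norm_grad_eq_dsum[OF N, of "{\<alpha>}" d v] that l2norm_product_eq_L2_set[of "{\<alpha>}" d "grad N v"]
    by (simp add: w_def b_def block_norm_nonneg)
  have finI: "finite (dsum_index d N)"
    unfolding dsum_index_def edge_grid_def using finite_grid by (intro finite_SigmaI) auto
  obtain u where u1: "l2norm {i \<in> dsum_index d N. snd i \<in> T} w \<le> u"
    and u2: "sqrt (1 - \<delta>) * u \<le> l2norm {..<q} (col_dsum d B w) + sqrt (1 + \<delta>) * \<tau>"
    and u3: "l2norm (dsum_index d N) w \<le> u + \<tau>"
    unfolding \<tau>_def
  \<comment> \<open>Groups of 4s blocks turn the denominator of the tail into 2 sqrt(s); with at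
    most s blocks in \<open>T\<close> this uses exactly d(s + 4s) = 5ds entries.\<close>
  proof (rule RIP_block_bound[where f = snd and T = T and m = "4 * s" and D = d and w = w,
        OF finI finite_grid _ linear_op_col_dsum[OF B] rip _ T(1)])
    show "snd i \<in> grid d N" if "i \<in> dsum_index d N" for i
      using that by (auto simp: dsum_index_def edge_grid_def)
    show "card {i \<in> dsum_index d N. snd i = g} \<le> d" for g
    proof -
      have "card {i \<in> dsum_index d N. snd i = g} \<le> card ((\<lambda>l. (l, g)) ` {1..d})"
        by (intro card_mono) (auto simp: dsum_index_def)
      also have "\<dots> \<le> d" using card_image_le[of "{1..d}" "\<lambda>l. (l, g)"] by simp
      finally show ?thesis .
    qed
    have "d * (card T + 4 * s) \<le> d * (5 * s)" using T(2) by (intro mult_left_mono) auto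
    then show "d * (card T + 4 * s) \<le> 5 * d * s" by (simp add: ac_simps)
  qed (use s in auto)
  have L2T: "L2_set b T \<le> u"
    using u1 l2norm_grad_eq_dsum[OF N T(1), of v] l2norm_product_eq_L2_set[OF finT, of d "grad N v"]
    by (simp add: w_def b_def)
  have "0 \<le> L2_set b T" by simp
  with L2T have u0: "0 \<le> u" by linarith
  let ?r = "sqrt (real s)"
  have r: "1 \<le> ?r" using s by simp
  have l1T: "(\<Sum>\<alpha>\<in>T. b \<alpha>) \<le> ?r * u"
  proof -
    have "(\<Sum>\<alpha>\<in>T. b \<alpha>) \<le> sqrt (real (card T)) * L2_set b T" by (rule sum_le_sqrt_card_L2_set)
    also have "\<dots> \<le> ?r * u" using T(2) L2T u0 by (intro mult_mono) auto
    finally show ?thesis .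
  qed
  \<comment> \<open>The cone constraint bounds the tail by the l1 norm on \<open>T\<close>, at most
    sqrt(s) u, plus 2 \<open>\<sigma>\<close>. The tail thus returns with half of the unknown
    \<open>u\<close>, which the margin 4/5 - 3/5 = 1/5 absorbs below.\<close>
  have \<tau>: "\<tau> \<le> u / 2 + \<sigma> / ?r"
  proof -
    have "\<tau> = (\<Sum>\<alpha>\<in>grid d N - T. b \<alpha>) / (2 * ?r)"
      unfolding \<tau>_def by (simp add: block real_sqrt_mult)
    also have "\<dots> \<le> (?r * u + 2 * \<sigma>) / (2 * ?r)"
      using cone l1T r unfolding b_def by (intro divide_right_mono) auto
    also have "\<dots> = u / 2 + \<sigma> / ?r" using r by (simp add: add_divide_distrib)
    finally show ?thesis .
  qed
  have lo: "4/5 \<le> sqrt (1 - \<delta>)" using \<delta> by (intro real_le_rsqrt) (simp add: power2_eq_square)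
  have hi: "sqrt (1 + \<delta>) \<le> 6/5" using \<delta> \<delta>0 by (intro real_le_lsqrt) (simp_all add: power2_eq_square)
  have solve_u: "u \<le> 5 * E + 6 * t" if "4/5 * u \<le> E + 6/5 * (u / 2 + t)" for t
    using that by (simp add: field_simps)
  have "4/5 * u \<le> sqrt (1 - \<delta>) * u" using lo u0 by (intro mult_right_mono)
  also have "\<dots> \<le> E + 6/5 * (u / 2 + \<sigma> / ?r)"
  proof -
    have "sqrt (1 + \<delta>) * \<tau> \<le> sqrt (1 + \<delta>) * (u / 2 + \<sigma> / ?r)"
      using \<tau> \<delta>0 by (intro mult_left_mono) auto
    also have "\<dots> \<le> 6/5 * (u / 2 + \<sigma> / ?r)"
      using hi u0 \<sigma> by (intro mult_right_mono) auto
    finally show ?thesis using u2 tube unfolding w_def by linarith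
  qed
  finally have u: "u \<le> 5 * E + 6 * (\<sigma> / ?r)" by (rule solve_u)
  have "l2norm (grid d N \<times> {1..d}) (grad N v) = l2norm {i \<in> dsum_index d N. snd i \<in> grid d N} w"
    unfolding w_def by (rule l2norm_grad_eq_dsum[OF N order_refl, symmetric])
  also have "{i \<in> dsum_index d N. snd i \<in> grid d N} = dsum_index d N"
    by (auto simp: dsum_index_def edge_grid_def)
  \<comment> \<open>The sum u + \<open>\<tau>\<close> is at most 3/2 u +
    \<open>\<sigma>\<close>/sqrt(s), which gives 15/2 E + 10 \<open>\<sigma>\<close>/sqrt(s); the 10
    is rounded up.\<close>
  also have "l2norm (dsum_index d N) w \<le> 15/2 * E + 11 * (\<sigma> / ?r)"
  proof -
    have "0 \<le> \<sigma> / ?r" using \<sigma> r by simp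
    then show ?thesis using u3 \<tau> u by linarith
  qed
  finally show "l2norm (grid d N \<times> {1..d}) (grad N v) \<le> 15/2 * E + 11 * (\<sigma> / ?r)" .
  have "TV2 d N v = (\<Sum>\<alpha>\<in>grid d N - T. b \<alpha>) + (\<Sum>\<alpha>\<in>T. b \<alpha>)"
    unfolding TV2_def norm12_def b_def by (rule sum.subset_diff[OF T(1) finite_grid])
  also have "\<dots> \<le> 2 * (?r * u) + 2 * \<sigma>" using cone l1T by (simp add: b_def)
  also have "\<dots> \<le> 2 * (?r * (5 * E + 6 * (\<sigma> / ?r))) + 2 * \<sigma>"
    using mult_left_mono[OF u, of ?r] r by simp
  also have "\<dots> = 10 * ?r * E + 14 * \<sigma>"
    using r by (simp add: field_simps)
  finally show "TV2 d N v \<le> 10 * ?r * E + 14 * \<sigma>" .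
qed

lemma norm12_restrict_compl:
  assumes "T \<subseteq> grid d N"
  shows "norm12 d N (\<lambda>i. w i - restrict_arr (T \<times> {1..d}) w i) = (\<Sum>\<alpha>\<in>grid d N - T. block_norm d w \<alpha>)"
proof -
  have eq: "block_norm d (\<lambda>i. w i - restrict_arr (T \<times> {1..d}) w i) \<alpha> =
      (if \<alpha> \<in> T then 0 else block_norm d w \<alpha>)" for \<alpha>
    by (auto simp: block_norm_def l2norm_def restrict_arr_def)
  show ?thesis
    unfolding norm12_def eq using finite_grid by (intro sum.mono_neutral_cong_right) auto
qed

text \<open>Already d ln 2 >= 1 for d >= 2. The first bound absorbs the number of scales; the second
  lets the noise term of the Sobolev inequality, which carries no logarithm, be put under
  it.\<close>

lemma log_growth:
  assumes "1 \<le> n" and "2 \<le> d"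
  shows "real n \<le> ln (real ((2 ^ n) ^ d))" and "1 \<le> ln (real ((2 ^ n) ^ d))"
proof -
  have ln: "ln (real ((2 ^ n) ^ d)) = real n * (real d * ln 2)"
    by (simp add: ln_realpow mult_ac)
  have "2 * (1/2) \<le> real d * ln 2"
    using assms(2) ln_2_less_1 ln2_ge_two_thirds by (intro mult_mono) auto
  then have "real n * 1 \<le> real n * (real d * ln 2)" by (intro mult_left_mono) auto
  moreover have "1 \<le> real n" using assms(1) by simp
  ultimately show "real n \<le> ln (real ((2 ^ n) ^ d))" "1 \<le> ln (real ((2 ^ n) ^ d))"
    unfolding ln by linarith+
qed

text \<open>The constants stay explicit so that their dependence can be read off. In (iii), the 2 is
  the diameter of the feasible tube in units of \<open>\<epsilon>\<close>, 2^d counts wavelet types,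
  and 30 comes from the total variation bound.\<close>

lemma recovery_bounds:
  fixes n d s p q :: nat and \<epsilon> :: real
  assumes d: "2 \<le> d" and n: "1 \<le> n" and N: "N = 2 ^ n" and s: "1 \<le> s"
    and A: "linear_op (grid d N) p A"
    and ripA: "RIP (haar_index d n) p (\<lambda>c. A (haar_adjoint d n c)) (2 * d * s) \<delta>\<^sub>A"
    and B: "\<forall>l\<in>{1..d}. linear_op (edge_grid d N l) q (B l)"
    and ripB: "RIP (dsum_index d N) q (col_dsum d B) (5 * d * s) \<delta>\<^sub>B" and \<delta>B: "\<delta>\<^sub>B < 1 / 3"
    and m: "m = 2 * d * q + p"
    and y: "\<forall>k<m. y k = stacked_op d N p q A B x k + \<xi> k" and noise: "l2norm {..<m} \<xi> \<le> \<epsilon>"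
    and xh: "is_arg_min (TV2 d N) (\<lambda>z. l2norm {..<m} (\<lambda>k. stacked_op d N p q A B z k - y k) \<le> \<epsilon>) xh"
    and T: "T \<subseteq> grid d N" "card T \<le> s"
  defines "\<sigma> \<equiv> norm12 d N (\<lambda>i. grad N x i - restrict_arr (T \<times> {1..d}) (grad N x) i)"
    and "err \<equiv> \<lambda>\<alpha>. x \<alpha> - xh \<alpha>"
  shows "l2norm (grid d N \<times> {1..d}) (grad N err) \<le> 30 * (\<sigma> / sqrt (real s) + sqrt (real d) * \<epsilon>)"
    and "TV2 d N err \<le> 30 * (\<sigma> + sqrt (real s * real d) * \<epsilon>)"
    and "l2norm (grid d N) err \<le>
      (2 / sqrt (1 - \<delta>\<^sub>A) + (sqrt (1 + \<delta>\<^sub>A) / sqrt (1 - \<delta>\<^sub>A) + 1) * 2 ^ d * 30) *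
        (ln (real (N ^ d)) * (\<sigma> / sqrt (real s) + sqrt (real d) * \<epsilon>))"
proof -
  let ?M = "stacked_op d N p q A B"
  let ?r = "sqrt (real s)" and ?rd = "sqrt (real d)"
  have N2: "2 \<le> N" unfolding N using n power_increasing[of 1 n "2::nat"] by simp
  have \<epsilon>: "0 \<le> \<epsilon>" using noise l2norm_nonneg[of "{..<m}" \<xi>] by linarith
  have feas: "l2norm {..<m} (\<lambda>k. ?M x k - y k) \<le> \<epsilon>"
  proof -
    have "l2norm {..<m} (\<lambda>k. ?M x k - y k) = l2norm {..<m} \<xi>"
      unfolding l2norm_def using y by (intro arg_cong[of _ _ sqrt] sum.cong) auto
    then show ?thesis using noise by simp
  qed
  \<comment> \<open>The true array is feasible because its residual is the negative of the noise, so
    minimality compares \<open>xh\<close> with it.\<close>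
  have feash: "l2norm {..<m} (\<lambda>k. ?M xh k - y k) \<le> \<epsilon>" and "TV2 d N xh \<le> TV2 d N x"
    using xh feas by (auto simp: is_arg_min_def not_less)
  from TV_cone_constraint[OF T(1) this(2)]
  have cone: "(\<Sum>\<alpha>\<in>grid d N - T. block_norm d (grad N err) \<alpha>) \<le>
      (\<Sum>\<alpha>\<in>T. block_norm d (grad N err) \<alpha>) + 2 * \<sigma>"
    unfolding err_def \<sigma>_def norm12_restrict_compl[OF T(1)] .
  have \<sigma>0: "0 \<le> \<sigma>" by (simp add: \<sigma>_def norm12_def block_norm_nonneg sum_nonneg)
  have Merr: "l2norm {..<m} (?M err) \<le> 2 * \<epsilon>"
  proof -
    have "l2norm {..<m} (?M err) = l2norm {..<m} (\<lambda>k. (?M x k - y k) - (?M xh k - y k))"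
      unfolding err_def stacked_op_diff[OF A] by simp
    also have "\<dots> \<le> 2 * \<epsilon>"
      using l2norm_triangle_diff[of "{..<m}" "\<lambda>k. ?M x k - y k" "\<lambda>k. ?M xh k - y k"] feas feash by linarith
    finally show ?thesis .
  qed
  have tube: "l2norm {..<q} (col_dsum d B (\<lambda>(l, \<alpha>). dir_deriv l err \<alpha>)) \<le> 3 * ?rd * \<epsilon>"
  proof -
    have "l2norm {..<q} (col_dsum d B (\<lambda>(l, \<alpha>). dir_deriv l err \<alpha>)) \<le> sqrt (2 * real d) * l2norm {..<m} (?M err)"
      unfolding m by (rule stacked_op_controls_derivatives[OF N2 B])
    also have "\<dots> \<le> sqrt (2 * real d) * (2 * \<epsilon>)" by (intro mult_left_mono Merr) simp
    also have "\<dots> = sqrt 2 * 2 * (?rd * \<epsilon>)" by (simp add: real_sqrt_mult)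
    also have "\<dots> \<le> 3 * (?rd * \<epsilon>)"
    proof (rule mult_right_mono)
      have "sqrt 2 \<le> 3/2" by (intro real_le_lsqrt) (simp_all add: power2_eq_square)
      then show "sqrt 2 * 2 \<le> 3" by simp
    qed (use \<epsilon> in simp)
    finally show ?thesis by simp
  qed
  note rec = gradient_recovery[OF N2 s B ripB \<delta>B T cone tube \<sigma>0]
  \<comment> \<open>With E = 3 sqrt(d) \<open>\<epsilon>\<close> (from 2 sqrt 2 <= 3) the
    coefficients are 45/2 and 11 in (i), 30 and 14 in (ii); the largest one serves as the common
    constant.\<close>
  have "0 \<le> \<sigma> / ?r" "0 \<le> ?rd * \<epsilon>" using \<sigma>0 \<epsilon> by simp_all
  then show "l2norm (grid d N \<times> {1..d}) (grad N err) \<le> 30 * (\<sigma> / ?r + ?rd * \<epsilon>)"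
    using rec(1) by (simp add: algebra_simps)
  have "TV2 d N err \<le> 30 * (sqrt (real s * real d) * \<epsilon>) + 14 * \<sigma>"
    using rec(2) by (simp add: real_sqrt_mult mult_ac)
  then show TV: "TV2 d N err \<le> 30 * (\<sigma> + sqrt (real s * real d) * \<epsilon>)"
    using \<sigma>0 by (simp add: algebra_simps)
  let ?X = "\<sigma> / ?r + ?rd * \<epsilon>" and ?L = "ln (real (N ^ d))"
  let ?a = "2 / sqrt (1 - \<delta>\<^sub>A)" and ?b = "sqrt (1 + \<delta>\<^sub>A) / sqrt (1 - \<delta>\<^sub>A) + 1"
  have \<delta>A: "0 < \<delta>\<^sub>A" "\<delta>\<^sub>A < 1" using ripA by (auto simp: RIP_def)
  have X: "0 \<le> ?X" using \<sigma>0 \<epsilon> by simp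
  have L: "real n \<le> ?L" "1 \<le> ?L" using log_growth[OF n d] unfolding N by auto
  have "TV2 d N err / ?r \<le> 30 * (\<sigma> + sqrt (real s * real d) * \<epsilon>) / ?r"
    using TV by (rule divide_right_mono) simp
  also have "\<dots> = 30 * ?X" using s by (simp add: real_sqrt_mult field_simps)
  finally have TVr: "TV2 d N err / ?r \<le> 30 * ?X" .
  have Aerr: "l2norm {..<p} (A err) \<le> 2 * \<epsilon>"
  proof -
    have "l2norm {..<p} (A err) = l2norm {..<p} (?M err)"
      by (intro l2norm_cong) (simp add: stacked_op_A)
    also have "\<dots> \<le> l2norm {..<m} (?M err)"
      unfolding l2norm_def m by (intro real_sqrt_le_mono sum_mono2) auto
    finally show ?thesis using Merr by linarith
  qed
  have "l2norm (grid d N) err \<le> l2norm {..<p} (A err) / sqrt (1 - \<delta>\<^sub>A) +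
      ?b * (real n * 2 ^ d * TV2 d N err / ?r)"
    unfolding N by (rule strong_Sobolev[OF d s A[unfolded N] ripA])
  also have "\<dots> \<le> ?a * (?L * ?X) + ?b * (2 ^ d * 30) * (?L * ?X)"
  proof (rule add_mono)
    \<comment> \<open>The bare \<open>\<epsilon>\<close> from the outputs of \<open>A\<close> is
      inflated by sqrt(d) >= 1 and by the logarithm, also at least 1, to fit the shape of
      (iii).\<close>
    have "\<epsilon> * 1 \<le> ?rd * \<epsilon>" using \<epsilon> d mult_right_mono[of 1 ?rd \<epsilon>] by simp
    also have "\<dots> \<le> 1 * ?X" using \<sigma>0 by simp
    also have "\<dots> \<le> ?L * ?X" using L(2) X by (intro mult_right_mono)
    finally have "2 * \<epsilon> / sqrt (1 - \<delta>\<^sub>A) \<le> 2 * (?L * ?X) / sqrt (1 - \<delta>\<^sub>A)"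
      using \<delta>A by (intro divide_right_mono mult_left_mono) auto
    moreover have "l2norm {..<p} (A err) / sqrt (1 - \<delta>\<^sub>A) \<le> 2 * \<epsilon> / sqrt (1 - \<delta>\<^sub>A)"
      using Aerr \<delta>A by (intro divide_right_mono) auto
    ultimately show "l2norm {..<p} (A err) / sqrt (1 - \<delta>\<^sub>A) \<le> ?a * (?L * ?X)" by simp
    have "real n * (2 ^ d * (TV2 d N err / ?r)) \<le> ?L * (2 ^ d * (30 * ?X))"
      using L TVr by (intro mult_mono) (auto simp: TV2_def norm12_def block_norm_nonneg sum_nonneg)
    then have "?b * (real n * (2 ^ d * (TV2 d N err / ?r))) \<le> ?b * (?L * (2 ^ d * (30 * ?X)))"
      using \<delta>A by (intro mult_left_mono) auto
    then show "?b * (real n * 2 ^ d * TV2 d N err / ?r) \<le> ?b * (2 ^ d * 30) * (?L * ?X)"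
      by (simp only: times_divide_eq_right mult.assoc mult.left_commute mult.commute)
  qed
  also have "\<dots> = (?a + ?b * 2 ^ d * 30) * (?L * ?X)"
    by (simp only: distrib_right mult.assoc)
  finally show "l2norm (grid d N) err \<le> (?a + ?b * 2 ^ d * 30) * (?L * ?X)" .
qed

text \<open>\<open>xh\<close> ranges over all minimizers, which covers any rule for selecting one.
  The bound \<open>n \<ge> 1\<close> excludes the one-point grid, where ln(N^d) = 0 would force
  exact recovery in (iii) despite the noise.\<close>

theorem mainTheorem1:
  shows "\<exists>C::real. C > 0 \<and>
    (\<forall>d::nat. \<forall>\<delta>\<^sub>A::real. d \<ge> 2 \<and> 0 < \<delta>\<^sub>A \<and> \<delta>\<^sub>A < 1 \<longrightarrow>
      (\<exists>K::real. K > 0 \<and>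
        (\<forall>(n::nat) (N::nat) (s::nat) (p::nat) (q::nat) (\<delta>\<^sub>B::real)
           (A :: (mindex \<Rightarrow> complex) \<Rightarrow> nat \<Rightarrow> complex)
           (B :: nat \<Rightarrow> (mindex \<Rightarrow> complex) \<Rightarrow> nat \<Rightarrow> complex).
          n \<ge> 1 \<and> N = 2 ^ n \<and> s \<ge> 1 \<and> p \<ge> 1 \<and> q \<ge> 1 \<and>
          linear_op (grid d N) p A \<and>
          RIP (haar_index d n) p (\<lambda>c. A (haar_adjoint d n c)) (2 * d * s) \<delta>\<^sub>A \<and>
          (\<forall>l\<in>{1..d}. linear_op (edge_grid d N l) q (B l)) \<and>
          RIP (dsum_index d N) q (col_dsum d B) (5 * d * s) \<delta>\<^sub>B \<and> \<delta>\<^sub>B < 1 / 3 \<longrightarrow>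
          (\<forall>(m::nat) M (x :: mindex \<Rightarrow> complex) (xh :: mindex \<Rightarrow> complex)
             (y :: nat \<Rightarrow> complex) (\<xi> :: nat \<Rightarrow> complex) (\<epsilon>::real) (T :: mindex set) S.
            m = 2 * d * q + p \<and> M = stacked_op d N p q A B \<and>
            (\<forall>k<m. y k = M x k + \<xi> k) \<and> l2norm {..<m} \<xi> \<le> \<epsilon> \<and>
            is_arg_min (TV2 d N) (\<lambda>z. l2norm {..<m} (\<lambda>k. M z k - y k) \<le> \<epsilon>) xh \<and>
            largest_blocks d N s (grad N x) T \<and> S = T \<times> {1..d} \<longrightarrow>
            (let \<sigma> = norm12 d N (\<lambda>i. grad N x i - restrict_arr S (grad N x) i);
                 err = (\<lambda>\<alpha>. x \<alpha> - xh \<alpha>)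
             in l2norm (grid d N \<times> {1..d}) (grad N err)
                  \<le> C * (\<sigma> / sqrt (real s) + sqrt (real d) * \<epsilon>) \<and>
                TV2 d N err \<le> C * (\<sigma> + sqrt (real s * real d) * \<epsilon>) \<and>
                l2norm (grid d N) err
                  \<le> K * (ln (real (N ^ d)) * (\<sigma> / sqrt (real s) + sqrt (real d) * \<epsilon>)))))))"
proof (rule exI[of _ 30], intro conjI allI impI)
  fix d :: nat and \<delta>\<^sub>A :: real
  assume d\<delta>: "d \<ge> 2 \<and> 0 < \<delta>\<^sub>A \<and> \<delta>\<^sub>A < 1"
  define K where "K = 2 / sqrt (1 - \<delta>\<^sub>A) + (sqrt (1 + \<delta>\<^sub>A) / sqrt (1 - \<delta>\<^sub>A) + 1) * 2 ^ d * 30"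
  have K: "0 < K"
    unfolding K_def using d\<delta> by (intro add_pos_pos mult_pos_pos divide_pos_pos) auto
  show "\<exists>K::real. K > 0 \<and>
        (\<forall>(n::nat) (N::nat) (s::nat) (p::nat) (q::nat) (\<delta>\<^sub>B::real)
           (A :: (mindex \<Rightarrow> complex) \<Rightarrow> nat \<Rightarrow> complex)
           (B :: nat \<Rightarrow> (mindex \<Rightarrow> complex) \<Rightarrow> nat \<Rightarrow> complex).
          n \<ge> 1 \<and> N = 2 ^ n \<and> s \<ge> 1 \<and> p \<ge> 1 \<and> q \<ge> 1 \<and>
          linear_op (grid d N) p A \<and>
          RIP (haar_index d n) p (\<lambda>c. A (haar_adjoint d n c)) (2 * d * s) \<delta>\<^sub>A \<and>
          (\<forall>l\<in>{1..d}. linear_op (edge_grid d N l) q (B l)) \<and>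
          RIP (dsum_index d N) q (col_dsum d B) (5 * d * s) \<delta>\<^sub>B \<and> \<delta>\<^sub>B < 1 / 3 \<longrightarrow>
          (\<forall>(m::nat) M (x :: mindex \<Rightarrow> complex) (xh :: mindex \<Rightarrow> complex)
             (y :: nat \<Rightarrow> complex) (\<xi> :: nat \<Rightarrow> complex) (\<epsilon>::real) (T :: mindex set) S.
            m = 2 * d * q + p \<and> M = stacked_op d N p q A B \<and>
            (\<forall>k<m. y k = M x k + \<xi> k) \<and> l2norm {..<m} \<xi> \<le> \<epsilon> \<and>
            is_arg_min (TV2 d N) (\<lambda>z. l2norm {..<m} (\<lambda>k. M z k - y k) \<le> \<epsilon>) xh \<and>
            largest_blocks d N s (grad N x) T \<and> S = T \<times> {1..d} \<longrightarrow>
            (let \<sigma> = norm12 d N (\<lambda>i. grad N x i - restrict_arr S (grad N x) i);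
                 err = (\<lambda>\<alpha>. x \<alpha> - xh \<alpha>)
             in l2norm (grid d N \<times> {1..d}) (grad N err)
                  \<le> 30 * (\<sigma> / sqrt (real s) + sqrt (real d) * \<epsilon>) \<and>
                TV2 d N err \<le> 30 * (\<sigma> + sqrt (real s * real d) * \<epsilon>) \<and>
                l2norm (grid d N) err
                  \<le> K * (ln (real (N ^ d)) * (\<sigma> / sqrt (real s) + sqrt (real d) * \<epsilon>)))))"
  proof (intro exI[of _ K] conjI allI impI K, elim conjE)
    fix n N s p q m :: nat and \<delta>\<^sub>B \<epsilon> :: real and A B M x xh y \<xi> T and S :: "(mindex \<times> nat) set"
    assume n: "1 \<le> n" and N: "N = 2 ^ n" and s: "1 \<le> s"
      and A: "linear_op (grid d N) p A"
      and ripA: "RIP (haar_index d n) p (\<lambda>c. A (haar_adjoint d n c)) (2 * d * s) \<delta>\<^sub>A"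
      and B: "\<forall>l\<in>{1..d}. linear_op (edge_grid d N l) q (B l)"
      and ripB: "RIP (dsum_index d N) q (col_dsum d B) (5 * d * s) \<delta>\<^sub>B" and \<delta>B: "\<delta>\<^sub>B < 1 / 3"
      and m: "m = 2 * d * q + p" and M: "M = stacked_op d N p q A B"
      and y: "\<forall>k<m. y k = M x k + \<xi> k" and noise: "l2norm {..<m} \<xi> \<le> \<epsilon>"
      and xh: "is_arg_min (TV2 d N) (\<lambda>z. l2norm {..<m} (\<lambda>k. M z k - y k) \<le> \<epsilon>) xh"
      and T: "largest_blocks d N s (grad N x) T" and S: "S = T \<times> {1..d}"
    have T': "T \<subseteq> grid d N" "card T \<le> s" using T by (auto simp: largest_blocks_def)
    have d: "2 \<le> d" using d\<delta> by simp
    note bounds = recovery_bounds[OF d n N s A ripA B ripB \<delta>B m y[unfolded M] noise xh[unfolded M] T']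
    show "let \<sigma> = norm12 d N (\<lambda>i. grad N x i - restrict_arr S (grad N x) i);
              err = (\<lambda>\<alpha>. x \<alpha> - xh \<alpha>)
          in l2norm (grid d N \<times> {1..d}) (grad N err)
               \<le> 30 * (\<sigma> / sqrt (real s) + sqrt (real d) * \<epsilon>) \<and>
             TV2 d N err \<le> 30 * (\<sigma> + sqrt (real s * real d) * \<epsilon>) \<and>
             l2norm (grid d N) err
               \<le> K * (ln (real (N ^ d)) * (\<sigma> / sqrt (real s) + sqrt (real d) * \<epsilon>))"
      unfolding Let_def K_def S using bounds by blast
  qed
qed simp

end
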